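(* Let $N\ge1$ be an integer, $\lambda>0$ and $N/(N+\lambda)<q<2N/(2N+\lambda)$. Then there is a minimizer for $\mathcal C^{\mathrm{rel}}_{N,\lambda,q}$, i.e. there exist a nonnegative function $\rho\in L^1\cap L^q(\mathbb R^N)$ with $\rho\not\equiv0$ and a number $M\ge0$ such that $\mathcal Q[\rho,M]=\mathcal C^{\mathrm{rel}}_{N,\lambda,q}$.
   Context: For $p>0$, $\rho\in L^p(\mathbb R^N)$ means that $\rho$ is measurable and $\int_{\mathbb R^N}|\rho|^p\,dx<\infty$ (also when $p<1$). Let $\alpha:=\frac{2N-q(2N+\lambda)}{N(1-q)}$ and, for measurable $\rho\ge0$, $I_\lambda[\rho]:=\iint_{\mathbb R^N\times\mathbb R^N}\rho(x)|x-y|^\lambda\rho(y)\,dx\,dy$. For $0\le\rho\in L^1\cap L^q(\mathbb R^N)$, $\rho\not\equiv0$, and $M\ge0$, set $$\mathcal Q[\rho,M]:=\frac{I_\lambda[\rho]+2M\int_{\mathbb R^N}|x|^\lambda\rho(x)\,dx}{\left(\int_{\mathbb R^N}\rho\,dx+M\right)^{\alpha}\left(\int_{\mathbb R^N}\rho^q\,dx\right)^{(2-\alpha)/q}}$$ and $$\mathcal C^{\mathrm{rel}}_{N,\lambda,q}:=\inf\left\{\mathcal Q[\rho,M]:\ 0\le\rho\in L^1\cap L^q(\mathbb R^N),\ \rho\not\equiv0,\ M\ge0\right\}.$$ *)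

theory Defs
  imports "HOL-Analysis.Analysis"
begin

definition Lp :: "real \<Rightarrow> (real ^ 'n \<Rightarrow> real) set" where
  "Lp p = {\<rho> \<in> borel_measurable lebesgue. (\<integral>\<^sup>+x. ennreal (\<bar>\<rho> x\<bar> powr p) \<partial>lebesgue) < \<infinity>}"

definition alpha :: "nat \<Rightarrow> real \<Rightarrow> real \<Rightarrow> real" where
  "alpha N l q = (2 * real N - q * (2 * real N + l)) / (real N * (1 - q))"

text \<open>The interaction energy and the moment below may be infinite for a density in the admissible
  class, so they take values in \<^typ>\<open>ennreal\<close>.\<close>

definition energy :: "real \<Rightarrow> (real ^ 'n \<Rightarrow> real) \<Rightarrow> ennreal" where
  "energy l \<rho> = (\<integral>\<^sup>+y. (\<integral>\<^sup>+x. ennreal (\<rho> x * norm (x - y) powr l * \<rho> y) \<partial>lebesgue) \<partial>lebesgue)"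

definition moment :: "real \<Rightarrow> (real ^ 'n \<Rightarrow> real) \<Rightarrow> ennreal" where
  "moment l \<rho> = (\<integral>\<^sup>+x. ennreal (norm x powr l * \<rho> x) \<partial>lebesgue)"

text \<open>The members of the Lebesgue spaces are represented by functions; accordingly
  \<open>\<rho>\<close> not vanishing identically means that \<open>\<rho>\<close> is not zero almost everywhere.\<close>

definition densities :: "real \<Rightarrow> (real ^ 'n \<Rightarrow> real) set" where
  "densities q = {\<rho> \<in> Lp 1 \<inter> Lp q. (\<forall>x. 0 \<le> \<rho> x) \<and> \<not> (AE x in lebesgue. \<rho> x = 0)}"

text \<open>For \<open>\<rho> \<in> densities q\<close> and \<open>M \<ge> 0\<close> (and \<open>q > 0\<close>) the two integrals in the denominator
  are finite and positive, so the quotient is infinite only if its numerator is. For \<open>M = 0\<close> the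
  moment term is \<open>0\<close> even if the moment is infinite.\<close>

definition Q_rel :: "real \<Rightarrow> real \<Rightarrow> (real ^ 'n \<Rightarrow> real) \<Rightarrow> real \<Rightarrow> ennreal" where
  "Q_rel l q \<rho> M =
     (energy l \<rho> + 2 * ennreal M * moment l \<rho>) /
     ennreal (((\<integral>x. \<rho> x \<partial>lebesgue) + M) powr alpha CARD('n) l q *
              (\<integral>x. \<rho> x powr q \<partial>lebesgue) powr ((2 - alpha CARD('n) l q) / q))"

text \<open>The first argument carries the dimension \<open>CARD('n)\<close>.\<close>

definition C_rel :: "'n::finite itself \<Rightarrow> real \<Rightarrow> real \<Rightarrow> ennreal" where
  "C_rel _ l q = Inf {Q_rel l q \<rho> M | (\<rho> :: real ^ 'n \<Rightarrow> real) M. \<rho> \<in> densities q \<and> M \<ge> 0}"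

end

theory Submission
  imports Defs
begin

text \<open>
  Put \<open>V\<^sub>\<rho>(y) = \<integral>|x - y|\<^sup>\<lambda> \<rho>(x) dx\<close>. The numerator of the quotient is the interaction energy of the
  measure \<open>\<rho> dx + M \<delta>\<^sub>0\<close>, so a minimizing sequence can be dilated to have
  \<open>\<integral>\<rho>\<^sub>j + M\<^sub>j = \<integral>\<rho>\<^sub>j\<^sup>q = 1\<close> and then translated, moving the Dirac mass to a point \<open>z\<^sub>j\<close>, so that
  \<open>V\<^sub>\<rho>(0)\<close> stays bounded along the sequence. No rearrangement is used. Instead, \<open>\<rho>\<^sub>j\<close> is truncated
  to \<open>f\<^sub>j = min \<rho>\<^sub>j (\<kappa>\<^sub>j 1\<^bsub>B(0,\<kappa>\<^sub>j)\<^esub>)\<close>, with \<open>\<kappa>\<^sub>j \<rightarrow> \<infinity>\<close> so slowly that along an ultrafilter \<open>\<integral>\<^sub>A f\<^sub>j\<close>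
  converges to \<open>\<integral>\<^sub>A h\<close> for every measurable \<open>A\<close>.
  The remaining mass \<open>1 - \<integral>f\<^sub>j\<close> costs at least \<open>2 (1 - \<integral>f\<^sub>j) inf V\<close> for the potential \<open>V\<close> of \<open>f\<^sub>j\<close>,
  that is, it may be moved to a single point \<open>y\<^sub>j\<close>, and the moment bound makes the \<open>y\<^sub>j\<close>
  converge to some \<open>y\<close>. Energy and potential are lower semicontinuous, so \<open>h\<close> together with the mass
  \<open>M = 1 - \<integral>h\<close> at \<open>y\<close> has numerator at most the infimum. Finally \<open>\<integral>h\<^sup>q \<ge> 1\<close>: as \<open>q < 1\<close> the
  functional \<open>\<integral>\<rho>\<^sup>q\<close> is concave, hence weakly upper semicontinuous on balls, and \<open>q > N/(N+\<lambda>)\<close> makes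
  its tails uniformly small under the moment bound. Translating \<open>y\<close> to the origin gives a minimizer.
\<close>

section \<open>Limits along an ultrafilter\<close>

text \<open>A free ultrafilter: being finer than \<open>sequentially\<close>, it inherits all
  ordinary limits, and the dichotomy clause makes every sequence in a compact set converge along
  it.\<close>

definition ultra :: "nat filter \<Rightarrow> bool" where
  "ultra G \<longleftrightarrow> G \<noteq> bot \<and> G \<le> sequentially \<and>
    (\<forall>P. eventually P G \<or> eventually (\<lambda>n. \<not> P n) G)"

text \<open>Zorn's lemma gives a minimal proper filter below \<open>sequentially\<close>; the
  infimum of a nonempty chain stays proper because the chain is a filter base. If restricting
  \<open>G\<close> to \<open>P\<close> leaves a proper filter, minimality puts \<open>P\<close> into
  \<open>G\<close>; otherwise the negation of \<open>P\<close> already holds eventually.\<close>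

lemma ultra_exists: "\<exists>G. ultra G"
proof -
  let ?A = "{G :: nat filter. G \<noteq> bot \<and> G \<le> sequentially}"
  let ?P = "\<lambda>F G :: nat filter. G \<le> F"
  have "\<exists>m\<in>?A. \<forall>a\<in>?A. ?P m a \<longrightarrow> a = m"
  proof (rule predicate_Zorn)
    show "partial_order_on ?A (relation_of ?P ?A)"
      by (rule partial_order_on_relation_ofI) auto
  next
    fix C assume C: "C \<in> Chains (relation_of ?P ?A)"
    then have CA: "C \<subseteq> ?A" by (rule Chains_relation_of)
    show "\<exists>u\<in>?A. \<forall>a\<in>C. ?P a u"
    proof (cases "C = {}")
      case True
      then show ?thesis by (intro bexI[of _ sequentially]) auto
    next
      case False
      have base: "\<exists>x\<in>C. x \<le> inf F H" if "F \<in> C" "H \<in> C" for F H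
        using that C by (auto simp: Chains_def relation_of_def)
      have "Inf C \<noteq> bot"
        using eventually_Inf_base[OF False base, of "\<lambda>_. False"] CA
        by (auto simp: trivial_limit_def)
      moreover have "Inf C \<le> sequentially"
        using False CA by (metis (mono_tags, lifting) Inf_lower2 all_not_in_conv mem_Collect_eq subsetD)
      ultimately show ?thesis by (intro bexI[of _ "Inf C"]) (auto intro: Inf_lower)
    qed
  qed
  then obtain G where G: "G \<noteq> bot" "G \<le> sequentially"
    and min: "\<And>H. H \<noteq> bot \<Longrightarrow> H \<le> sequentially \<Longrightarrow> H \<le> G \<Longrightarrow> H = G" by auto
  have "eventually P G \<or> eventually (\<lambda>n. \<not> P n) G" for P
  proof (cases "inf G (principal {n. P n}) = bot")
    case True
    then have "eventually (\<lambda>n. \<not> P n) G"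
      by (simp add: trivial_limit_def eventually_inf_principal)
    then show ?thesis ..
  next
    case False
    then have "inf G (principal {n. P n}) = G"
      using G(2) by (intro min) (auto intro: le_infI1)
    moreover have "eventually P (inf G (principal {n. P n}))"
      by (simp add: eventually_inf_principal)
    ultimately show ?thesis by simp
  qed
  with G show ?thesis unfolding ultra_def by blast
qed

text \<open>Compactness provides a cluster point. Along an ultrafilter a cluster point is a limit,
  since not being eventually inside a neighbourhood means being eventually outside it.\<close>

lemma ultra_convergent:
  assumes "ultra G" "compact K" "eventually (\<lambda>n. u n \<in> K) G"
  shows "\<exists>c\<in>K. (u \<longlongrightarrow> c) G"
proof -
  have "filtermap u G \<noteq> bot" "eventually (\<lambda>x. x \<in> K) (filtermap u G)"
    using assms by (auto simp: filtermap_bot_iff ultra_def eventually_filtermap)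
  then obtain c where c: "c \<in> K" "inf (nhds c) (filtermap u G) \<noteq> bot"
    using assms(2) unfolding compact_filter by blast
  have "eventually (\<lambda>n. u n \<in> S) G" if S: "open S" "c \<in> S" for S
  proof (rule ccontr)
    assume "\<not> ?thesis"
    then have "eventually (\<lambda>n. u n \<notin> S) G"
      using assms(1) unfolding ultra_def by blast
    then have "eventually (\<lambda>x. x \<notin> S) (inf (nhds c) (filtermap u G))"
      by (intro filter_leD[OF inf_le2]) (simp add: eventually_filtermap)
    moreover have "eventually (\<lambda>x. x \<in> S) (inf (nhds c) (filtermap u G))"
      by (intro filter_leD[OF inf_le1] eventually_nhds_in_open S)
    ultimately have "eventually (\<lambda>x. False) (inf (nhds c) (filtermap u G))"
      by eventually_elim simp
    with c(2) show False by (simp add: trivial_limit_def)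
  qed
  with c(1) show ?thesis by (auto simp: tendsto_def)
qed

locale ultralimit =
  fixes G :: "nat filter"
  assumes ultra: "ultra G"
begin

lemma nonbot: "G \<noteq> bot" and le_seq: "G \<le> sequentially"
  using ultra by (auto simp: ultra_def)

text \<open>As \<open>ennreal\<close> is compact, this limit exists for every sequence. It replaces
  the extraction of subsequences and is additive and monotone without side conditions.\<close>

definition L :: "(nat \<Rightarrow> ennreal) \<Rightarrow> ennreal" where "L u = Lim G u"

lemma tendsto_L: "(u \<longlongrightarrow> L u) G"
proof -
  obtain c where "(u \<longlongrightarrow> c) G"
    using ultra_convergent[OF ultra compact_UNIV, of u] by auto
  then show ?thesis unfolding L_def using tendsto_Lim[OF nonbot] by metis
qed

lemma L_eqI: "(u \<longlongrightarrow> c) G \<Longrightarrow> L u = c"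
  unfolding L_def using tendsto_Lim[OF nonbot] .

lemma L_eq_LIMSEQ: "u \<longlonglongrightarrow> c \<Longrightarrow> L u = c"
  by (rule L_eqI) (rule tendsto_mono[OF le_seq])

lemma eventually_seq: "eventually P sequentially \<Longrightarrow> eventually P G"
  using le_seq by (rule filter_leD)

lemma L_const [simp]: "L (\<lambda>_. c) = c"
  by (rule L_eqI) simp

lemma L_add: "L (\<lambda>j. u j + v j) = L u + L v"
  by (intro L_eqI tendsto_add tendsto_L)

lemma L_cmult: "c < top \<Longrightarrow> L (\<lambda>j. c * u j) = c * L u"
  by (intro L_eqI ennreal_tendsto_cmult tendsto_L)

lemma L_mono_ev: "eventually (\<lambda>j. u j \<le> v j) G \<Longrightarrow> L u \<le> L v"
  by (rule tendsto_le[OF nonbot tendsto_L tendsto_L])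

lemma L_mono: "(\<And>j. u j \<le> v j) \<Longrightarrow> L u \<le> L v"
  by (rule L_mono_ev) simp

lemma L_sum: "L (\<lambda>j. \<Sum>i\<in>I. u i j) = (\<Sum>i\<in>I. L (u i))"
  by (intro L_eqI tendsto_sum tendsto_L)

lemma L_mult: 
  assumes "L u < top" "L v < top"
  shows "L (\<lambda>j. u j * v j) = L u * L v"
  using assms by (intro L_eqI tendsto_mult_ennreal tendsto_L) auto

text \<open>Fatou's lemma for series: finite partial sums commute with \<open>L\<close>, and each is
  bounded by the full series.\<close>

lemma L_suminf_ge: "(\<Sum>i. L (u i)) \<le> L (\<lambda>j. \<Sum>i. u i j)"
proof -
  have "(\<Sum>i<n. L (u i)) \<le> L (\<lambda>j. \<Sum>i. u i j)" for n
    unfolding L_sum[symmetric] by (intro L_mono sum_le_suminf) auto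
  then show ?thesis by (simp add: suminf_eq_SUP SUP_le_iff)
qed

text \<open>Finite additivity survives the limit by itself. Domination by the integrable
  \<open>\<psi>\<close> bounds the mass outside the first \<open>n\<close> sets uniformly in
  \<open>j\<close>, so no mass escapes into the remainders \<open>?B n\<close>.\<close>

lemma dominated_countably_additive:
  assumes u[measurable]: "\<And>j. u j \<in> borel_measurable M"
    and psi[measurable]: "\<psi> \<in> borel_measurable M"
    and dom: "\<And>j x. u j x \<le> \<psi> x"
    and fin: "(\<integral>\<^sup>+x. \<psi> x \<partial>M) < top"
  shows "countably_additive (sets M) (\<lambda>A. L (\<lambda>j. \<integral>\<^sup>+x. u j x * indicator A x \<partial>M))"
proof (rule countably_additiveI)
  fix A :: "nat \<Rightarrow> _" assume A: "range A \<subseteq> sets M" "disjoint_family A"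
  let ?m = "\<lambda>A. L (\<lambda>j. \<integral>\<^sup>+x. u j x * indicator A x \<partial>M)"
  let ?B = "\<lambda>n. \<Union>(range A) - (\<Union>i<n. A i)"
  have [measurable]: "\<And>i. A i \<in> sets M" using A by auto
  have split: "?m (\<Union>(range A)) = (\<Sum>i<n. ?m (A i)) + ?m (?B n)" for n
  proof -
    have "indicator (\<Union>(range A)) x = (\<Sum>i<n. indicator (A i) x) + (indicator (?B n) x :: ennreal)" for x
    proof -
      have "(\<Sum>i<n. indicator (A i) x) = (indicator (\<Union>i<n. A i) x :: ennreal)"
        using A(2) by (subst indicator_UN_disjoint)
          (auto simp: disjoint_family_on_def)
      then show ?thesis by (auto split: split_indicator)
    qed
    then have "?m (\<Union>(range A)) = L (\<lambda>j. \<integral>\<^sup>+x. (\<Sum>i<n. u j x * indicator (A i) x) + u j x * indicator (?B n) x \<partial>M)"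
      by (simp only: distrib_left sum_distrib_left)
    also have "\<dots> = L (\<lambda>j. (\<Sum>i<n. \<integral>\<^sup>+x. u j x * indicator (A i) x \<partial>M) + (\<integral>\<^sup>+x. u j x * indicator (?B n) x \<partial>M))"
      by (subst nn_integral_add) (measurable, simp add: nn_integral_sum del: sum_mult_indicator)
    finally show ?thesis by (simp add: L_add L_sum)
  qed
  have "(\<lambda>n. (\<integral>\<^sup>+x. \<psi> x * indicator (?B n) x \<partial>M)) \<longlonglongrightarrow> (\<integral>\<^sup>+x. 0 \<partial>M)"
  proof (rule nn_integral_dominated_convergence[where w=\<psi>])
    show "AE x in M. (\<lambda>n. \<psi> x * indicator (?B n) x) \<longlonglongrightarrow> 0"
    proof (rule AE_I2)
      fix x
      show "(\<lambda>n. \<psi> x * indicator (?B n) x) \<longlonglongrightarrow> 0"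
      proof (cases "\<exists>i. x \<in> A i")
        case True
        then obtain i where "x \<in> A i" ..
        then have "eventually (\<lambda>n. \<psi> x * indicator (?B n) x = 0) sequentially"
          by (intro eventually_sequentiallyI[of "Suc i"]) (auto split: split_indicator)
        then show ?thesis by (rule tendsto_eventually)
      qed auto
    qed
  qed (use fin in \<open>auto split: split_indicator\<close>)
  then have B0: "(\<lambda>n. (\<integral>\<^sup>+x. \<psi> x * indicator (?B n) x \<partial>M)) \<longlonglongrightarrow> 0" by simp
  have "?m (?B n) \<le> (\<integral>\<^sup>+x. \<psi> x * indicator (?B n) x \<partial>M)" for n
    by (subst L_const[symmetric]) (intro L_mono nn_integral_mono mult_right_mono dom; simp)
  then have "(\<lambda>n. ?m (?B n)) \<longlonglongrightarrow> 0"
    by (intro tendsto_sandwich[OF _ _ tendsto_const B0]) auto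
  from tendsto_add[OF summable_LIMSEQ this, of "\<lambda>i. ?m (A i)"]
  have "(\<lambda>n. ?m (\<Union>(range A))) \<longlonglongrightarrow> (\<Sum>i. ?m (A i))"
    by (simp add: split[symmetric])
  then show "(\<Sum>i. ?m (A i)) = ?m (\<Union>(range A))"
    using LIMSEQ_unique tendsto_const by blast
qed

text \<open>\<open>\<kappa> j\<close> is the largest \<open>k \<le> j\<close> with
  \<open>P k j\<close>: the bound by \<open>j\<close> makes a maximum exist, and
  \<open>P 0 j\<close> makes the set nonempty. For fixed \<open>k\<close>, eventually
  \<open>k\<close> itself is a candidate.\<close>

lemma diagonal_index:
  assumes ev: "\<And>k. eventually (P k) G" and P0: "\<And>j. P 0 j"
  shows "\<exists>\<kappa>::nat \<Rightarrow> nat. (\<forall>j. P (\<kappa> j) j) \<and> (\<forall>k. eventually (\<lambda>j. k \<le> \<kappa> j) G)"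
proof -
  let ?S = "\<lambda>j. {k. k \<le> j \<and> P k j}"
  have fin: "finite (?S j)" for j by (rule finite_subset[of _ "{..j}"]) auto
  have ne: "?S j \<noteq> {}" for j using P0[of j] by auto
  have "P (Max (?S j)) j" for j using Max_in[OF fin ne, of j] by simp
  moreover have "eventually (\<lambda>j. k \<le> Max (?S j)) G" for k
    using ev[of k] eventually_seq[OF eventually_ge_at_top[of k]]
    by eventually_elim (auto intro!: Max_ge fin)
  ultimately show ?thesis by (intro exI[of _ "\<lambda>j. Max (?S j)"]) auto
qed

end

section \<open>Truncated weak limits\<close>

lemma ennreal_add_right_cancel_leD: "a + c \<le> b + c \<Longrightarrow> c < top \<Longrightarrow> a \<le> b" for a b c :: ennreal
  by (auto simp: add.commute[of _ c] ennreal_add_left_cancel_le)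

context ultralimit
begin

text \<open>
  The set functions \<open>A \<mapsto> lim \<integral>\<^sub>A min (r\<^sub>j) (\<psi>\<^sub>k)\<close> are measures by domination. The function \<open>h\<close> is
  the Radon--Nikodym density of their supremum over \<open>k\<close>, and a diagonal choice of \<open>\<kappa>\<close> prevents the
  truncations from having more mass in the limit than \<open>h\<close>.
\<close>

lemma biting:
  fixes r \<psi> :: "nat \<Rightarrow> 'a \<Rightarrow> ennreal"
  assumes "sigma_finite_measure M"
    and r[measurable]: "\<And>j. r j \<in> borel_measurable M"
    and r1: "\<And>j. (\<integral>\<^sup>+x. r j x \<partial>M) \<le> 1"
    and psi[measurable]: "\<And>k. \<psi> k \<in> borel_measurable M"
    and psi_fin: "\<And>k. (\<integral>\<^sup>+x. \<psi> k x \<partial>M) < top"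
    and psi_mono: "\<And>x. mono (\<lambda>k. \<psi> k x)"
  shows "\<exists>\<kappa> h. (\<forall>k. eventually (\<lambda>j. k \<le> \<kappa> j) G) \<and> h \<in> borel_measurable M \<and> (\<forall>x. 0 \<le> h x) \<and>
    (\<forall>A\<in>sets M. L (\<lambda>j. \<integral>\<^sup>+x. min (r j x) (\<psi> (\<kappa> j) x) * indicator A x \<partial>M)
                = (\<integral>\<^sup>+x. ennreal (h x) * indicator A x \<partial>M))"
proof -
  interpret sigma_finite_measure M by fact
  let ?f = "\<lambda>k j x. min (r j x) (\<psi> k x)"
  define m where "m k A = L (\<lambda>j. \<integral>\<^sup>+x. ?f k j x * indicator A x \<partial>M)" for k A
  define \<nu> where "\<nu> A = (SUP k. m k A)" for A
  have m_mono: "mono (\<lambda>k. m k A)" for A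
    unfolding m_def
    by (intro monoI L_mono nn_integral_mono mult_right_mono min.mono order_refl) (auto intro: monoD[OF psi_mono])
  have m_ca: "countably_additive (sets M) (m k)" for k
    unfolding m_def by (rule dominated_countably_additive[where \<psi>="\<psi> k"]) (use psi_fin in auto)
  \<comment> \<open>Monotonicity in \<open>k\<close> lets the supremum pass through the countable
    sum.\<close>
  have ca: "countably_additive (sets M) \<nu>"
  proof (rule countably_additiveI)
    fix A :: "nat \<Rightarrow> _" assume A: "range A \<subseteq> sets M" "disjoint_family A" "\<Union>(range A) \<in> sets M"
    have "(\<Sum>i. \<nu> (A i)) = (SUP k. \<Sum>i. m k (A i))"
      unfolding \<nu>_def by (rule ennreal_suminf_SUP_eq) (use m_mono in \<open>auto simp: incseq_def mono_def\<close>)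
    also have "\<dots> = \<nu> (\<Union>(range A))"
      unfolding \<nu>_def using m_ca A by (simp add: countably_additive_def)
    finally show "(\<Sum>i. \<nu> (A i)) = \<nu> (\<Union>(range A))" .
  qed
  have m0: "m k A = 0" if "A \<in> null_sets M" for k A
  proof -
    have "(\<integral>\<^sup>+x. ?f k j x * indicator A x \<partial>M) = 0" for j
      using AE_not_in[OF that] by (subst nn_integral_0_iff_AE) (use that in \<open>auto simp: null_setsD2\<close>)
    then show ?thesis by (simp add: m_def)
  qed
  have "\<nu> {} = 0" using m0[of "{}"] by (simp add: \<nu>_def)
  then have ms: "measure_space (space M) (sets M) \<nu>"
    using ca sets.sigma_algebra_axioms by (simp add: measure_space_def positive_def)
  define N where "N = measure_of (space M) (sets M) \<nu>"
  have sN: "sets N = sets M" "space N = space M" by (simp_all add: N_def)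
  have eN: "emeasure N A = \<nu> A" if "A \<in> sets M" for A
    unfolding N_def using that ms by (intro emeasure_measure_of_sigma) (auto simp: measure_space_def)
  have "absolutely_continuous M N"
    unfolding absolutely_continuous_def
  proof
    fix A assume A: "A \<in> null_sets M"
    then have "emeasure N A = 0" using m0[OF A] by (simp add: eN null_setsD2 \<nu>_def)
    then show "A \<in> null_sets N" using A by (simp add: null_sets_def sN)
  qed
  from Radon_Nikodym[OF this sN(1)] obtain H where H[measurable]: "H \<in> borel_measurable M" and HN: "density M H = N"
    by blast
  have nuH: "(\<integral>\<^sup>+x. H x * indicator A x \<partial>M) = \<nu> A" if "A \<in> sets M" for A
    using that by (simp add: emeasure_density[symmetric] HN eN)
  have m1: "m k A \<le> 1" if "A \<in> sets M" for k A
  proof -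
    have "(\<integral>\<^sup>+x. ?f k j x * indicator A x \<partial>M) \<le> (\<integral>\<^sup>+x. r j x \<partial>M)" for j
      by (intro nn_integral_mono) (auto split: split_indicator)
    then have "(\<integral>\<^sup>+x. ?f k j x * indicator A x \<partial>M) \<le> 1" for j
      using r1 order_trans by blast
    then show ?thesis unfolding m_def by (subst L_const[of 1, symmetric]) (rule L_mono)
  qed
  have nu1: "\<nu> A \<le> 1" if "A \<in> sets M" for A
    unfolding \<nu>_def using m1[OF that] by (simp add: SUP_le_iff)
  have "(\<integral>\<^sup>+x. H x \<partial>M) = \<nu> (space M)"
    using nuH[of "space M"] by (simp cong: nn_integral_cong)
  then have "(\<integral>\<^sup>+x. H x \<partial>M) \<noteq> \<infinity>"
    using nu1[of "space M"] by (auto simp: top_unique)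
  then have Hfin: "AE x in M. H x \<noteq> \<infinity>"
    by (intro nn_integral_noteq_infinite) auto
  \<comment> \<open>Passing to a real-valued density changes \<open>H\<close> only on a null set,
    because \<open>H\<close> has integral at most 1.\<close>
  define h where "h x = enn2real (H x)" for x
  have [measurable]: "h \<in> borel_measurable M" unfolding h_def by measurable
  have hA: "(\<integral>\<^sup>+x. ennreal (h x) * indicator A x \<partial>M) = \<nu> A" if "A \<in> sets M" for A
  proof -
    have "(\<integral>\<^sup>+x. ennreal (h x) * indicator A x \<partial>M) = (\<integral>\<^sup>+x. H x * indicator A x \<partial>M)"
      by (rule nn_integral_cong_AE) (use Hfin in \<open>auto simp: h_def ennreal_enn2real_if\<close>)
    then show ?thesis using nuH[OF that] by simp
  qed
  \<comment> \<open>For \<open>k = 0\<close> the slack is 1, so the bound follows from the total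
    mass being at most 1. For every \<open>k\<close> the limit mass \<open>m k (space M)\<close>
    lies strictly below the bound, so the bound holds eventually.\<close>
  let ?P = "\<lambda>k j. (\<integral>\<^sup>+x. ?f k j x \<partial>M) \<le> \<nu> (space M) + inverse (of_nat (Suc k))"
  have "\<exists>\<kappa>::nat \<Rightarrow> nat. (\<forall>j. ?P (\<kappa> j) j) \<and> (\<forall>k. eventually (\<lambda>j. k \<le> \<kappa> j) G)"
  proof (rule diagonal_index)
    show "?P 0 j" for j
    proof -
      have "(\<integral>\<^sup>+x. ?f 0 j x \<partial>M) \<le> (\<integral>\<^sup>+x. r j x \<partial>M)" by (intro nn_integral_mono) auto
      also have "\<dots> \<le> \<nu> (space M) + 1" using r1[of j] by (rule add_increasing[OF zero_le])
      finally show ?thesis by simp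
    qed
    show "eventually (?P k) G" for k
    proof -
      have "m k (space M) \<le> \<nu> (space M)" unfolding \<nu>_def by (intro SUP_upper) simp
      also have "\<dots> < \<nu> (space M) + inverse (of_nat (Suc k))"
        using nu1[of "space M"] ennreal_add_left_cancel_less[of "\<nu> (space M)" 0 "inverse (of_nat (Suc k))"]
        by (auto simp: top_unique zero_less_iff_neq_zero)
      finally have "eventually (\<lambda>j. (\<integral>\<^sup>+x. ?f k j x * indicator (space M) x \<partial>M) < \<nu> (space M) + inverse (of_nat (Suc k))) G"
        unfolding m_def by (rule order_tendstoD(2)[OF tendsto_L])
      then show ?thesis
        by eventually_elim (simp add: less_imp_le cong: nn_integral_cong)
    qed
  qed
  then obtain \<kappa> :: "nat \<Rightarrow> nat" where kP: "\<And>j. ?P (\<kappa> j) j" and kinf: "\<And>k. eventually (\<lambda>j. k \<le> \<kappa> j) G"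
    by blast
  define F where "F A = L (\<lambda>j. \<integral>\<^sup>+x. ?f (\<kappa> j) j x * indicator A x \<partial>M)" for A
  have F_ge: "\<nu> A \<le> F A" for A
    unfolding \<nu>_def
  proof (rule SUP_least)
    fix k
    show "m k A \<le> F A" unfolding m_def F_def
      by (rule L_mono_ev, rule eventually_mono[OF kinf[of k]])
        (auto intro!: nn_integral_mono mult_right_mono min.mono monoD[OF psi_mono])
  qed
  have F_total: "F (space M) \<le> \<nu> (space M)"
  proof (rule ennreal_le_epsilon)
    fix e :: real assume "0 < e"
    then obtain k where k: "inverse (real (Suc k)) < e" using reals_Archimedean by blast
    have "F (space M) \<le> L (\<lambda>j. \<nu> (space M) + ennreal e)"
      unfolding F_def
    proof (rule L_mono_ev, rule eventually_mono[OF kinf[of k]])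
      fix j assume "k \<le> \<kappa> j"
      then have "inverse (real (Suc (\<kappa> j))) \<le> e"
        using k by (intro order_trans[OF le_imp_inverse_le less_imp_le[OF k]]) auto
      then have "inverse (of_nat (Suc (\<kappa> j))) \<le> ennreal e"
        by (metis ennreal_leI ennreal_of_nat_eq_real_of_nat inverse_ennreal of_nat_0_less_iff zero_less_Suc)
      then have "(\<integral>\<^sup>+x. ?f (\<kappa> j) j x \<partial>M) \<le> \<nu> (space M) + ennreal e"
        using order_trans[OF kP[of j] add_left_mono] by blast
      then show "(\<integral>\<^sup>+x. ?f (\<kappa> j) j x * indicator (space M) x \<partial>M) \<le> \<nu> (space M) + ennreal e"
        by (simp cong: nn_integral_cong)
    qed
    then show "F (space M) \<le> \<nu> (space M) + ennreal e" by simp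
  qed
  \<comment> \<open>\<open>F\<close> dominates \<open>\<nu>\<close> on \<open>A\<close> and on its
    complement, while its total does not exceed that of \<open>\<nu>\<close>; since all values are
    finite, equality on \<open>A\<close> follows.\<close>
  have F_eq: "F A = \<nu> A" if A[measurable]: "A \<in> sets M" for A
  proof -
    have "F A + F (space M - A) = F (space M)"
      unfolding F_def L_add[symmetric]
      by (subst nn_integral_add[symmetric]) (auto intro!: arg_cong[where f=L] nn_integral_cong ext split: split_indicator)
    moreover have "\<nu> A + \<nu> (space M - A) = \<nu> (space M)"
      using A sN sets.sets_into_space[OF A] by (simp add: eN[symmetric] plus_emeasure Un_absorb1)
    ultimately have "F A + F (space M - A) \<le> \<nu> A + \<nu> (space M - A)" using F_total by simp
    also have "\<dots> \<le> \<nu> A + F (space M - A)" by (intro add_left_mono F_ge)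
    finally have le: "F A + F (space M - A) \<le> \<nu> A + F (space M - A)" .
    have "F (space M - A) \<le> F (space M)"
      unfolding F_def by (intro L_mono nn_integral_mono) (auto split: split_indicator)
    also have "\<dots> < top" using F_total nu1[of "space M"] by (auto simp: less_top[symmetric] top_unique)
    finally have "F A \<le> \<nu> A" using le by (rule ennreal_add_right_cancel_leD[rotated])
    with F_ge show ?thesis by (simp add: antisym)
  qed
  show ?thesis
    by (intro exI[of _ \<kappa>] exI[of _ h]) (use kinf F_eq hA in \<open>auto simp: F_def h_def\<close>)
qed

end

text \<open>Setwise convergence of the measures with densities \<open>f j\<close>. Pointwise
  finiteness of \<open>h\<close> makes multiplication by \<open>h x\<close> continuous on
  \<open>ennreal\<close>.\<close>

locale weak_limit = ultralimit +
  fixes M :: "'a measure" and f :: "nat \<Rightarrow> 'a \<Rightarrow> ennreal" and h :: "'a \<Rightarrow> ennreal"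
  assumes f[measurable]: "\<And>j. f j \<in> borel_measurable M" and h[measurable]: "h \<in> borel_measurable M"
    and weak: "\<And>A. A \<in> sets M \<Longrightarrow> L (\<lambda>j. \<integral>\<^sup>+x. f j x * indicator A x \<partial>M) = (\<integral>\<^sup>+x. h x * indicator A x \<partial>M)"
    and h_fin: "(\<integral>\<^sup>+x. h x \<partial>M) < top"
    and h_less_top: "\<And>x. h x < top"
begin

lemma weak_total: "L (\<lambda>j. \<integral>\<^sup>+x. f j x \<partial>M) = (\<integral>\<^sup>+x. h x \<partial>M)"
  using weak[of "space M"] by (simp cong: nn_integral_cong)

text \<open>Induction over nonnegative measurable functions: indicators, finite multiples and sums
  pass through \<open>L\<close>, and a monotone supremum keeps only the inequality.\<close>

lemma weak_lower:
  assumes "\<phi> \<in> borel_measurable M"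
  shows "(\<integral>\<^sup>+x. h x * \<phi> x \<partial>M) \<le> L (\<lambda>j. \<integral>\<^sup>+x. f j x * \<phi> x \<partial>M)"
  using assms
proof (induction rule: borel_measurable_induct)
  case (cong g1 g2)
  then show ?case by (simp cong: nn_integral_cong)
next
  case (set A)
  then show ?case by (simp add: weak)
next
  case (mult u c)
  have *: "(\<integral>\<^sup>+x. f j x * (c * u x) \<partial>M) = c * (\<integral>\<^sup>+x. f j x * u x \<partial>M)" for j
    using mult by (subst nn_integral_cmult[symmetric]) (auto simp: ac_simps)
  have "(\<integral>\<^sup>+x. h x * (c * u x) \<partial>M) = c * (\<integral>\<^sup>+x. h x * u x \<partial>M)"
    using mult by (subst nn_integral_cmult[symmetric]) (auto simp: ac_simps)
  also have "\<dots> \<le> c * L (\<lambda>j. \<integral>\<^sup>+x. f j x * u x \<partial>M)" by (intro mult_left_mono mult) auto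
  also have "\<dots> = L (\<lambda>j. \<integral>\<^sup>+x. f j x * (c * u x) \<partial>M)"
    unfolding * using mult by (subst L_cmult) auto
  finally show ?case .
next
  case (add u v)
  then show ?case by (simp add: distrib_left nn_integral_add L_add add_mono)
next
  case (seq U)
  have [measurable]: "U i \<in> borel_measurable M" for i by fact
  have "(\<integral>\<^sup>+x. h x * (SUP i. U i) x \<partial>M) = (\<integral>\<^sup>+x. (SUP i. h x * U i x) \<partial>M)"
    by (simp add: SUP_mult_left_ennreal image_comp)
  also have "\<dots> = (SUP i. \<integral>\<^sup>+x. h x * U i x \<partial>M)"
    using \<open>incseq U\<close> by (intro nn_integral_monotone_convergence_SUP) (auto simp: incseq_def le_fun_def intro!: mult_left_mono)
  also have "\<dots> \<le> L (\<lambda>j. \<integral>\<^sup>+x. f j x * (SUP i. U i) x \<partial>M)"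
  proof (rule SUP_least)
    fix i
    have "(\<integral>\<^sup>+x. h x * U i x \<partial>M) \<le> L (\<lambda>j. \<integral>\<^sup>+x. f j x * U i x \<partial>M)" by (rule seq)
    also have "\<dots> \<le> L (\<lambda>j. \<integral>\<^sup>+x. f j x * (SUP i. U i) x \<partial>M)"
      by (intro L_mono nn_integral_mono mult_left_mono) (auto simp: le_fun_def image_comp intro: SUP_upper)
    finally show "(\<integral>\<^sup>+x. h x * U i x \<partial>M) \<le> L (\<lambda>j. \<integral>\<^sup>+x. f j x * (SUP i. U i) x \<partial>M)" .
  qed
  finally show ?case .
qed

text \<open>\<open>weak_lower\<close> applies to \<open>\<phi>\<close> and to
  \<open>c - \<phi>\<close>. Their integrals add up to \<open>c\<close> times the total mass, which
  converges, so neither inequality can be strict.\<close>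

lemma weak_bounded:
  assumes [measurable]: "\<phi> \<in> borel_measurable M" and c: "\<And>x. \<phi> x \<le> c" "c < top"
  shows "L (\<lambda>j. \<integral>\<^sup>+x. f j x * \<phi> x \<partial>M) = (\<integral>\<^sup>+x. h x * \<phi> x \<partial>M)"
proof (rule antisym[OF _ weak_lower])
  have split: "(\<integral>\<^sup>+x. g x * \<phi> x \<partial>M) + (\<integral>\<^sup>+x. g x * (c - \<phi> x) \<partial>M) = c * (\<integral>\<^sup>+x. g x \<partial>M)"
    if [measurable]: "g \<in> borel_measurable M" for g
  proof -
    have "(\<integral>\<^sup>+x. g x * \<phi> x \<partial>M) + (\<integral>\<^sup>+x. g x * (c - \<phi> x) \<partial>M) = (\<integral>\<^sup>+x. g x * (\<phi> x + (c - \<phi> x)) \<partial>M)"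
      by (subst nn_integral_add[symmetric]) (auto simp: distrib_left)
    also have "\<dots> = (\<integral>\<^sup>+x. c * g x \<partial>M)"
      by (intro nn_integral_cong) (simp add: c add_diff_inverse_ennreal mult.commute)
    finally show ?thesis by (simp add: nn_integral_cmult)
  qed
  let ?C = "L (\<lambda>j. \<integral>\<^sup>+x. f j x * (c - \<phi> x) \<partial>M)"
  have "L (\<lambda>j. \<integral>\<^sup>+x. f j x * \<phi> x \<partial>M) + ?C = c * (\<integral>\<^sup>+x. h x \<partial>M)"
    unfolding L_add[symmetric] by (simp add: split L_cmult c weak_total)
  also have "\<dots> = (\<integral>\<^sup>+x. h x * \<phi> x \<partial>M) + (\<integral>\<^sup>+x. h x * (c - \<phi> x) \<partial>M)" by (simp add: split)
  also have "\<dots> \<le> (\<integral>\<^sup>+x. h x * \<phi> x \<partial>M) + ?C" by (intro add_left_mono weak_lower) auto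
  finally have le: "L (\<lambda>j. \<integral>\<^sup>+x. f j x * \<phi> x \<partial>M) + ?C \<le> (\<integral>\<^sup>+x. h x * \<phi> x \<partial>M) + ?C" .
  have "?C \<le> L (\<lambda>j. c * (\<integral>\<^sup>+x. f j x \<partial>M))"
  proof (rule L_mono)
    fix j
    have "(\<integral>\<^sup>+x. f j x * (c - \<phi> x) \<partial>M) \<le> (\<integral>\<^sup>+x. f j x * c \<partial>M)"
      by (intro nn_integral_mono mult_left_mono diff_le_self_ennreal) simp
    then show "(\<integral>\<^sup>+x. f j x * (c - \<phi> x) \<partial>M) \<le> c * (\<integral>\<^sup>+x. f j x \<partial>M)"
      by (simp only: nn_integral_multc[OF f] mult.commute[of c])
  qed
  also have "\<dots> < top" using c h_fin by (simp add: L_cmult weak_total ennreal_mult_less_top)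
  finally show "L (\<lambda>j. \<integral>\<^sup>+x. f j x * \<phi> x \<partial>M) \<le> (\<integral>\<^sup>+x. h x * \<phi> x \<partial>M)"
    using le by (rule ennreal_add_right_cancel_leD[rotated])
qed fact

end

section \<open>Lower semicontinuity of quadratic energies\<close>

definition pot :: "'a measure \<Rightarrow> ('a \<Rightarrow> 'a \<Rightarrow> ennreal) \<Rightarrow> ('a \<Rightarrow> ennreal) \<Rightarrow> 'a \<Rightarrow> ennreal" where
  "pot M k f y = (\<integral>\<^sup>+x. f x * k x y \<partial>M)"

definition bilin :: "'a measure \<Rightarrow> ('a \<Rightarrow> 'a \<Rightarrow> ennreal) \<Rightarrow> ('a \<Rightarrow> ennreal) \<Rightarrow> ('a \<Rightarrow> ennreal) \<Rightarrow> ennreal" where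
  "bilin M k f g = (\<integral>\<^sup>+y. (\<integral>\<^sup>+x. f x * k x y * g y \<partial>M) \<partial>M)"

section \<open>Kernels that factor through a countable partition\<close>

lemma nn_integral_countable_range:
  fixes c :: "'a \<Rightarrow> nat"
  assumes c[measurable]: "c \<in> M \<rightarrow>\<^sub>M count_space UNIV" and [measurable]: "g \<in> borel_measurable M"
  shows "(\<integral>\<^sup>+x. g x * F (c x) \<partial>M) = (\<Sum>n. F n * (\<integral>\<^sup>+x. g x * indicator (c -` {n} \<inter> space M) x \<partial>M))"
proof -
  have [measurable]: "c -` {n} \<inter> space M \<in> sets M" for n
    by (rule measurable_sets[OF c]) simp
  have "(\<integral>\<^sup>+x. g x * F (c x) \<partial>M) = (\<integral>\<^sup>+x. (\<Sum>n. F n * (g x * indicator (c -` {n} \<inter> space M) x)) \<partial>M)"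
  proof (rule nn_integral_cong)
    fix x assume x: "x \<in> space M"
    have "(\<Sum>n. F n * (g x * indicator (c -` {n} \<inter> space M) x)) = (\<Sum>n\<in>{c x}. F n * (g x * indicator (c -` {n} \<inter> space M) x))"
      by (rule suminf_finite) auto
    then show "g x * F (c x) = (\<Sum>n. F n * (g x * indicator (c -` {n} \<inter> space M) x))"
      using x by (simp add: mult.commute)
  qed
  also have "\<dots> = (\<Sum>n. F n * (\<integral>\<^sup>+x. g x * indicator (c -` {n} \<inter> space M) x \<partial>M))"
    by (subst nn_integral_suminf) (auto simp: nn_integral_cmult)
  finally show ?thesis .
qed

lemma bilin_countable_range:
  fixes c :: "'a \<Rightarrow> nat"
  assumes [measurable]: "c \<in> M \<rightarrow>\<^sub>M count_space UNIV" "g \<in> borel_measurable M"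
  shows "bilin M (\<lambda>x y. W (c x) (c y)) g g =
    (\<Sum>m. \<Sum>n. W n m * ((\<integral>\<^sup>+x. g x * indicator (c -` {n} \<inter> space M) x \<partial>M) *
                        (\<integral>\<^sup>+x. g x * indicator (c -` {m} \<inter> space M) x \<partial>M)))"
proof -
  let ?D = "\<lambda>n. (\<integral>\<^sup>+x. g x * indicator (c -` {n} \<inter> space M) x \<partial>M)"
  have "bilin M (\<lambda>x y. W (c x) (c y)) g g = (\<integral>\<^sup>+y. g y * (\<Sum>n. W n (c y) * ?D n) \<partial>M)"
    unfolding bilin_def
  proof (rule nn_integral_cong)
    fix y
    have "(\<integral>\<^sup>+x. g x * W (c x) (c y) * g y \<partial>M) = (\<integral>\<^sup>+x. g x * W (c x) (c y) \<partial>M) * g y"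
      by (rule nn_integral_multc) measurable
    then show "(\<integral>\<^sup>+x. g x * W (c x) (c y) * g y \<partial>M) = g y * (\<Sum>n. W n (c y) * ?D n)"
      using nn_integral_countable_range[of c M g "\<lambda>n. W n (c y)"] by (simp add: mult.commute)
  qed
  also have "\<dots> = (\<Sum>m. (\<Sum>n. W n m * ?D n) * ?D m)"
    by (rule nn_integral_countable_range) measurable
  also have "\<dots> = (\<Sum>m. \<Sum>n. W n m * (?D n * ?D m))"
    by (simp add: ennreal_suminf_multc[symmetric] mult.assoc)
  finally show ?thesis .
qed

context weak_limit
begin

text \<open>The energy is a double series in the masses of the cells of \<open>c\<close>. These
  masses converge to finite limits, hence so do their products, and \<open>L_suminf_ge\<close> is
  applied once to each sum.\<close>

lemma bilin_countable_range_lower: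
  fixes c :: "'a \<Rightarrow> nat" and W :: "nat \<Rightarrow> nat \<Rightarrow> real"
  assumes c[measurable]: "c \<in> M \<rightarrow>\<^sub>M count_space UNIV"
  shows "bilin M (\<lambda>x y. ennreal (W (c x) (c y))) h h \<le> L (\<lambda>j. bilin M (\<lambda>x y. ennreal (W (c x) (c y))) (f j) (f j))"
proof -
  let ?D = "\<lambda>g n. (\<integral>\<^sup>+x. g x * indicator (c -` {n} \<inter> space M) x \<partial>M)"
  have LD: "L (\<lambda>j. ?D (f j) n) = ?D h n" for n
    by (rule weak) measurable
  have fin: "?D h n < top" for n
    by (rule le_less_trans[OF _ h_fin]) (auto intro!: nn_integral_mono split: split_indicator)
  have "ennreal (W n m) * (?D h n * ?D h m) = L (\<lambda>j. ennreal (W n m) * (?D (f j) n * ?D (f j) m))" for n m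
    using fin by (subst L_cmult) (auto simp: LD L_mult)
  then have "bilin M (\<lambda>x y. ennreal (W (c x) (c y))) h h =
      (\<Sum>m. \<Sum>n. L (\<lambda>j. ennreal (W n m) * (?D (f j) n * ?D (f j) m)))"
    by (subst bilin_countable_range) auto
  also have "\<dots> \<le> (\<Sum>m. L (\<lambda>j. \<Sum>n. ennreal (W n m) * (?D (f j) n * ?D (f j) m)))"
    by (intro suminf_le L_suminf_ge) auto
  also have "\<dots> \<le> L (\<lambda>j. \<Sum>m. \<Sum>n. ennreal (W n m) * (?D (f j) n * ?D (f j) m))"
    by (rule L_suminf_ge)
  also have "\<dots> = L (\<lambda>j. bilin M (\<lambda>x y. ennreal (W (c x) (c y))) (f j) (f j))"
    by (subst bilin_countable_range) auto
  finally show ?thesis .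
qed

text \<open>
  Setwise convergence of \<open>f\<^sub>j\<close> only controls rectangles in the product space, so the kernel is
  approximated from below by kernels that factor through a countable set.
\<close>

lemma bilin_lower:
  fixes c :: "nat \<Rightarrow> 'a \<Rightarrow> nat" and W :: "nat \<Rightarrow> nat \<Rightarrow> nat \<Rightarrow> real" and k :: "'a \<Rightarrow> 'a \<Rightarrow> ennreal"
  assumes "sigma_finite_measure M" and c[measurable]: "\<And>m. c m \<in> M \<rightarrow>\<^sub>M count_space UNIV"
    and le: "\<And>m x y. ennreal (W m (c m x) (c m y)) \<le> k x y"
    and lim: "\<And>x y. (\<lambda>m. ennreal (W m (c m x) (c m y))) \<longlonglongrightarrow> k x y"
  shows "bilin M k h h \<le> L (\<lambda>j. bilin M k (f j) (f j))"
proof -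
  interpret sigma_finite_measure M by fact
  let ?k = "\<lambda>m x y. ennreal (W m (c m x) (c m y))"
  have "(\<lambda>m. h x * ?k m x y * h y) \<longlonglongrightarrow> h x * k x y * h y" for x y
  proof -
    have "(\<lambda>m. h x * h y * ?k m x y) \<longlonglongrightarrow> h x * h y * k x y"
      by (intro ennreal_tendsto_cmult lim) (simp add: ennreal_mult_less_top h_less_top)
    then show ?thesis by (simp add: ac_simps)
  qed
  \<comment> \<open>Writing the integrand as a liminf prepares Fatou's lemma, first in the inner
    variable and then in the outer one.\<close>
  then have eq: "h x * k x y * h y = liminf (\<lambda>m. h x * ?k m x y * h y)" for x y
    by (rule lim_imp_Liminf[OF trivial_limit_sequentially, symmetric])
  have [measurable]: "(\<lambda>(y, x). h x * ?k m x y * h y) \<in> borel_measurable (M \<Otimes>\<^sub>M M)" for m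
    by measurable
  have [measurable]: "(\<lambda>y. (\<integral>\<^sup>+x. h x * ?k m x y * h y \<partial>M)) \<in> borel_measurable M" for m
    by measurable
  have "bilin M k h h \<le> (\<integral>\<^sup>+y. liminf (\<lambda>m. \<integral>\<^sup>+x. h x * ?k m x y * h y \<partial>M) \<partial>M)"
    unfolding bilin_def eq
    by (intro nn_integral_mono nn_integral_liminf) measurable
  also have "\<dots> \<le> liminf (\<lambda>m. bilin M (?k m) h h)"
    unfolding bilin_def by (intro nn_integral_liminf) measurable
  also have "\<dots> \<le> liminf (\<lambda>m::nat. L (\<lambda>j. bilin M k (f j) (f j)))"
  proof (intro Liminf_mono always_eventually allI)
    fix m
    have "bilin M (?k m) h h \<le> L (\<lambda>j. bilin M (?k m) (f j) (f j))"
      by (rule bilin_countable_range_lower) measurable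
    also have "\<dots> \<le> L (\<lambda>j. bilin M k (f j) (f j))"
      unfolding bilin_def by (intro L_mono nn_integral_mono mult_right_mono mult_left_mono le) auto
    finally show "bilin M (?k m) h h \<le> L (\<lambda>j. bilin M k (f j) (f j))" .
  qed
  also have "\<dots> = L (\<lambda>j. bilin M k (f j) (f j))" by (simp add: Liminf_const)
  finally show ?thesis .
qed

end

section \<open>The power kernel\<close>

lemma sigma_finite_lebesgue: "sigma_finite_measure (lebesgue :: 'a::euclidean_space measure)"
proof
  let ?A = "range (\<lambda>n::nat. cball (0::'a) (real n))"
  have "x \<in> \<Union>?A" for x :: 'a
    using real_arch_simple[of "norm x"] by auto
  moreover have "emeasure lebesgue (cball (0::'a) r) \<noteq> \<infinity>" for r
    using emeasure_bounded_finite[of "cball (0::'a) r"] by auto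
  ultimately show "\<exists>A. countable A \<and> A \<subseteq> sets (lebesgue :: 'a measure) \<and> \<Union>A = space lebesgue \<and> (\<forall>a\<in>A. emeasure lebesgue a \<noteq> \<infinity>)"
    by (intro exI[of _ ?A]) auto
qed

text \<open>The product of \<open>lebesgue\<close> with itself is not complete, so kernels are shown
  measurable as Borel functions of the coordinates; this lemma and the next two supply the
  coordinates.\<close>

lemma measurable_lebesgue_borel [measurable]: "(\<lambda>x::'a::euclidean_space. x) \<in> borel_measurable lebesgue"
  by (rule measurable_completion) simp

lemma measurable_fst_lebesgue_borel [measurable]:
  "fst \<in> borel_measurable ((lebesgue :: 'a::euclidean_space measure) \<Otimes>\<^sub>M N)"
  using measurable_compose[OF measurable_fst measurable_lebesgue_borel] by simp

lemma measurable_snd_lebesgue_borel [measurable]: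
  "snd \<in> borel_measurable (N \<Otimes>\<^sub>M (lebesgue :: 'a::euclidean_space measure))"
  using measurable_compose[OF measurable_snd measurable_lebesgue_borel] by simp

text \<open>Here \<open>g\<close> is the part removed by truncation and \<open>c\<close> a Dirac
  mass at \<open>z\<close>. The self-energy of \<open>g\<close> is dropped; by symmetry of the
  kernel the two cross terms agree, and each is at least the mass of \<open>g\<close> times the
  lower bound \<open>v\<close> of the potential of \<open>f\<close>. The Dirac term is bounded in
  the same way.\<close>

lemma bilin_add_lower:
  fixes k :: "'a \<Rightarrow> 'a \<Rightarrow> ennreal"
  assumes "sigma_finite_measure M"
    and k: "(\<lambda>(x, y). k x y) \<in> borel_measurable (M \<Otimes>\<^sub>M M)" and sym: "\<And>x y. k x y = k y x"
    and f[measurable]: "f \<in> borel_measurable M" and g[measurable]: "g \<in> borel_measurable M"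
    and v: "\<And>y. v \<le> pot M k f y"
  shows "bilin M k f f + 2 * (((\<integral>\<^sup>+x. g x \<partial>M) + c) * v)
    \<le> bilin M k (\<lambda>x. f x + g x) (\<lambda>x. f x + g x) + 2 * c * pot M k (\<lambda>x. f x + g x) z"
proof -
  interpret sigma_finite_measure M by fact
  interpret P: pair_sigma_finite M M ..
  have k1[measurable]: "(\<lambda>(x, y). k x y) \<in> borel_measurable (M \<Otimes>\<^sub>M M)" by fact
  have [measurable]: "(\<lambda>(y, x). k x y) \<in> borel_measurable (M \<Otimes>\<^sub>M M)"
    using k1 sym by simp
  have [measurable]: "(\<lambda>x. k x y) \<in> borel_measurable M" if "y \<in> space M" for y
    using measurable_compose[OF measurable_Pair2'[OF that] k1] by simp
  have swap: "bilin M k g f = bilin M k f g"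
  proof -
    have "bilin M k g f = (\<integral>\<^sup>+x. (\<integral>\<^sup>+y. g x * k x y * f y \<partial>M) \<partial>M)"
      unfolding bilin_def by (rule P.Fubini') measurable
    also have "\<dots> = bilin M k f g"
      unfolding bilin_def by (intro nn_integral_cong) (simp add: sym[of "_::'a" "_::'a"] ac_simps)
    finally show ?thesis .
  qed
  have "(\<integral>\<^sup>+x. g x \<partial>M) * v = (\<integral>\<^sup>+y. g y * v \<partial>M)" by (simp add: nn_integral_multc)
  also have "\<dots> \<le> bilin M k f g"
    unfolding bilin_def
  proof (intro nn_integral_mono)
    fix y assume [measurable]: "y \<in> space M"
    have "(\<integral>\<^sup>+x. f x * k x y * g y \<partial>M) = pot M k f y * g y"
      unfolding pot_def by (rule nn_integral_multc) measurable
    then show "g y * v \<le> (\<integral>\<^sup>+x. f x * k x y * g y \<partial>M)"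
      using mult_left_mono[OF v[of y], of "g y"] by (simp add: mult.commute)
  qed
  finally have "(\<integral>\<^sup>+x. g x \<partial>M) * v \<le> bilin M k f g" .
  moreover have "c * v \<le> c * pot M k (\<lambda>x. f x + g x) z"
    by (intro mult_left_mono order_trans[OF v[of z]]) (auto simp: pot_def intro!: nn_integral_mono mult_right_mono)
  ultimately have "bilin M k f f + 2 * (((\<integral>\<^sup>+x. g x \<partial>M) + c) * v) \<le>
      bilin M k f f + 2 * (bilin M k f g + c * pot M k (\<lambda>x. f x + g x) z)"
    unfolding distrib_right[of _ _ v] by (intro add_left_mono mult_left_mono[where c="2::ennreal"] add_mono) simp_all
  also have "\<dots> = bilin M k f f + bilin M k g f + bilin M k f g + 2 * c * pot M k (\<lambda>x. f x + g x) z"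
    unfolding swap by (simp add: distrib_left mult_2 ac_simps)
  also have "bilin M k f f + bilin M k g f + bilin M k f g \<le> bilin M k (\<lambda>x. f x + g x) (\<lambda>x. f x + g x)"
  proof -
    have [measurable]: "(\<lambda>(y, x). u x * k x y * v y) \<in> borel_measurable (M \<Otimes>\<^sub>M M)"
      if [measurable]: "u \<in> borel_measurable M" "v \<in> borel_measurable M" for u v
      by measurable
    have "bilin M k f f + bilin M k g f + bilin M k f g
      = (\<integral>\<^sup>+y. (\<integral>\<^sup>+x. f x * k x y * f y + g x * k x y * f y + f x * k x y * g y \<partial>M) \<partial>M)"
      unfolding bilin_def
      by (simp add: nn_integral_add cong: nn_integral_cong)
    also have "\<dots> \<le> bilin M k (\<lambda>x. f x + g x) (\<lambda>x. f x + g x)"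
      unfolding bilin_def by (intro nn_integral_mono) (simp add: algebra_simps)
    finally show ?thesis .
  qed
  finally show ?thesis by (simp add: add_right_mono)
qed

definition ker :: "real \<Rightarrow> 'a::euclidean_space \<Rightarrow> 'a \<Rightarrow> ennreal" where
  "ker l x y = ennreal (norm (x - y) powr l)"

lemma ker_commute: "ker l x y = ker l y x"
  by (simp add: ker_def norm_minus_commute)

lemma measurable_ker: "(\<lambda>(x, y). ker l x y) \<in> borel_measurable (lebesgue \<Otimes>\<^sub>M lebesgue)"
  unfolding ker_def by measurable

lemma measurable_ker1 [measurable]: "(\<lambda>x. ker l x y) \<in> borel_measurable lebesgue"
  unfolding ker_def by measurable

locale weak_limit_lebesgue = weak_limit G lebesgue f h
  for G and f :: "nat \<Rightarrow> 'a::euclidean_space \<Rightarrow> ennreal" and h +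
  fixes l :: real
  assumes l: "0 < l"
begin

text \<open>Rounding both points to a countable dense set gives kernels with countable range;
  lowering the rounded distance by the maximal rounding error keeps them below the true
  kernel.\<close>

lemma ker_bilin_lower: "bilin lebesgue (ker l) h h \<le> L (\<lambda>j. bilin lebesgue (ker l) (f j) (f j))"
proof -
  obtain D :: "'a set" where D: "countable D" "\<And>X. open X \<Longrightarrow> X \<noteq> {} \<Longrightarrow> \<exists>d\<in>D. d \<in> X"
    by (erule countable_dense_setE)
  then have "D \<noteq> {}" by (metis empty_not_UNIV equals0D open_UNIV)
  define d where "d = from_nat_into D"
  have dense: "\<exists>n. dist x (d n) < e" if "0 < e" for x e
  proof -
    have "\<exists>a\<in>D. a \<in> ball x e" using that by (intro D) auto
    then show ?thesis
      using from_nat_into_surj[OF D(1)] unfolding d_def by (metis mem_ball)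
  qed
  \<comment> \<open>Taking the least index of a close dense point makes the rounding
    measurable.\<close>
  define c where "c m x = (LEAST n. dist x (d n) < 1 / real (Suc m))" for m x
  have c: "dist x (d (c m x)) < 1 / real (Suc m)" for m x
    unfolding c_def by (rule LeastI_ex) (rule dense, simp)
  \<comment> \<open>Each of the two roundings moves a point by less than \<open>1/(m+1)\<close>,
    hence the correction \<open>2/(m+1)\<close>; clipping at 0 keeps the base of the power
    nonnegative.\<close>
  define W where "W m a b = max 0 (dist (d a) (d b) - 2 / real (Suc m)) powr l" for m a b
  have close: "\<bar>dist (d (c m x)) (d (c m y)) - dist x y\<bar> \<le> 2 / real (Suc m)" for m x y
    using c[of x m] c[of y m] dist_triangle2[of "d (c m x)" "d (c m y)" x] dist_triangle[of x "d (c m y)" y] 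
       dist_triangle[of x y "d (c m x)"] dist_triangle[of "d (c m x)" y "d (c m y)"]
       dist_triangle[of "d (c m x)" "d (c m y)" x] dist_triangle[of x "d (c m y)" y]
    by (simp add: dist_commute)
  show ?thesis
  proof (rule bilin_lower[where c=c and W=W, OF sigma_finite_lebesgue])
    show "c m \<in> lebesgue \<rightarrow>\<^sub>M count_space UNIV" for m
      unfolding c_def by measurable
    show "ennreal (W m (c m x) (c m y)) \<le> ker l x y" for m x y
      unfolding W_def ker_def using close[of m x y] l
      by (intro ennreal_leI powr_mono2) (auto simp: dist_norm)
    show "(\<lambda>m. ennreal (W m (c m x) (c m y))) \<longlonglongrightarrow> ker l x y" for x y
    proof -
      have z: "(\<lambda>m. 2 / real (Suc m)) \<longlonglongrightarrow> 0"
        using LIMSEQ_inverse_real_of_nat by (intro tendsto_divide_0[OF tendsto_const] filterlim_at_top_imp_at_infinity filterlim_compose[OF filterlim_real_sequentially filterlim_Suc])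
      have "(\<lambda>m. dist (d (c m x)) (d (c m y)) - dist x y) \<longlonglongrightarrow> 0"
        using close by (intro Lim_null_comparison[OF _ z]) auto
      then have "(\<lambda>m. dist (d (c m x)) (d (c m y)) - 2 / real (Suc m)) \<longlonglongrightarrow> dist x y - 0"
        by (intro tendsto_diff z) (simp add: LIM_zero_iff)
      then have "(\<lambda>m. max 0 (dist (d (c m x)) (d (c m y)) - 2 / real (Suc m))) \<longlonglongrightarrow> max 0 (dist x y - 0)"
        by (intro tendsto_max tendsto_const)
      then show ?thesis
        unfolding W_def ker_def using l
        by (intro tendsto_ennrealI tendsto_powr') (auto simp: dist_norm)
    qed
  qed
qed

text \<open>The evaluation point moves with \<open>j\<close>. Lowering the distance to
  \<open>y\<close> by \<open>1/(m+1)\<close> gives a test function independent of \<open>j\<close>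
  that lies below the kernel at \<open>Y j\<close> as soon as \<open>Y j\<close> is that close to
  \<open>y\<close>; Fatou's lemma in \<open>m\<close> then removes the correction.\<close>

lemma ker_pot_lower:
  assumes y: "(Y \<longlongrightarrow> y) G"
  shows "pot lebesgue (ker l) h y \<le> L (\<lambda>j. pot lebesgue (ker l) (f j) (Y j))"
proof -
  let ?\<phi> = "\<lambda>m x. ennreal (max 0 (norm (x - y) - 1 / real (Suc m)) powr l)"
  have lim: "(\<lambda>m. h x * ?\<phi> m x) \<longlonglongrightarrow> h x * ker l x y" for x
  proof -
    have z: "(\<lambda>m. 1 / real (Suc m)) \<longlonglongrightarrow> 0"
      using LIMSEQ_inverse_real_of_nat by (simp add: inverse_eq_divide)
    have "(\<lambda>m. max 0 (norm (x - y) - 1 / real (Suc m))) \<longlonglongrightarrow> max 0 (norm (x - y) - 0)"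
      by (intro tendsto_max tendsto_diff z tendsto_const)
    then show ?thesis
      unfolding ker_def using l
      by (intro ennreal_tendsto_cmult[OF h_less_top] tendsto_ennrealI tendsto_powr') auto
  qed
  have "pot lebesgue (ker l) h y = (\<integral>\<^sup>+x. liminf (\<lambda>m. h x * ?\<phi> m x) \<partial>lebesgue)"
    unfolding pot_def using lim_imp_Liminf[OF trivial_limit_sequentially lim] by simp
  also have "\<dots> \<le> liminf (\<lambda>m. \<integral>\<^sup>+x. h x * ?\<phi> m x \<partial>lebesgue)"
    by (intro nn_integral_liminf) measurable
  also have "\<dots> \<le> liminf (\<lambda>m::nat. L (\<lambda>j. pot lebesgue (ker l) (f j) (Y j)))"
  proof (intro Liminf_mono always_eventually allI)
    fix m
    have "(\<integral>\<^sup>+x. h x * ?\<phi> m x \<partial>lebesgue) \<le> L (\<lambda>j. \<integral>\<^sup>+x. f j x * ?\<phi> m x \<partial>lebesgue)"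
      by (rule weak_lower) measurable
    also have "\<dots> \<le> L (\<lambda>j. pot lebesgue (ker l) (f j) (Y j))"
    proof (rule L_mono_ev)
      have "eventually (\<lambda>j. dist (Y j) y < 1 / real (Suc m)) G"
        by (rule tendstoD[OF y]) simp
      then show "eventually (\<lambda>j. (\<integral>\<^sup>+x. f j x * ?\<phi> m x \<partial>lebesgue) \<le> pot lebesgue (ker l) (f j) (Y j)) G"
      proof eventually_elim
        case (elim j)
        have "norm (x - y) - 1 / real (Suc m) \<le> norm (x - Y j)" for x
          using elim norm_triangle_ineq[of "x - Y j" "Y j - y"] by (simp add: dist_norm)
        then show ?case
          unfolding pot_def ker_def using l
          by (intro nn_integral_mono mult_left_mono ennreal_leI powr_mono2) auto
      qed
    qed
    finally show "(\<integral>\<^sup>+x. h x * ?\<phi> m x \<partial>lebesgue) \<le> L (\<lambda>j. pot lebesgue (ker l) (f j) (Y j))" .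
  qed
  also have "\<dots> = L (\<lambda>j. pot lebesgue (ker l) (f j) (Y j))" by (simp add: Liminf_const)
  finally show ?thesis .
qed

end

section \<open>Upper semicontinuity of the concave integral\<close>

text \<open>The weight is bounded by a series over dyadic balls. Volume times weight gives a
  geometric series of ratio \<open>2 powr (DIM('a) - p) < 1\<close>; the factor
  \<open>2 powr p\<close> in \<open>?a\<close> pays for \<open>norm x\<close> exceeding only
  \<open>2 ^ (k - 1)\<close>.\<close>

lemma nn_integral_weight_finite:
  assumes p: "real DIM('a::euclidean_space) < p"
  shows "(\<integral>\<^sup>+x. ennreal ((1 + norm (x::'a)) powr (-p)) \<partial>lebesgue) < top"
proof -
  let ?N = "DIM('a)"
  let ?V = "unit_ball_vol (real ?N)"
  let ?a = "\<lambda>k::nat. 2 powr p * 2 powr (- p * real k)"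
  have bound: "ennreal ((1 + norm x) powr (-p)) \<le> (\<Sum>k. ennreal (?a k) * indicator (cball 0 (2 ^ k)) x)" for x :: 'a
  proof -
    define k where "k = (LEAST k. norm x \<le> 2 ^ k)"
    have "\<exists>k. norm x \<le> 2 ^ k"
      using real_arch_pow[of 2 "norm x"] by (auto intro: less_imp_le)
    then have k: "norm x \<le> 2 ^ k" unfolding k_def by (rule LeastI_ex)
    have "(1 + norm x) powr (-p) \<le> ?a k"
    proof (cases k)
      case 0
      have "(1 + norm x) powr (-p) \<le> 1 powr (-p)" using p by (intro powr_mono2') auto
      also have "\<dots> \<le> ?a k" using 0 p ge_one_powr_ge_zero[of 2 p] by simp
      finally show ?thesis .
    next
      case (Suc m)
      have "\<not> norm x \<le> 2 ^ m" using Suc not_less_Least[of m "\<lambda>k. norm x \<le> 2 ^ k"] by (simp add: k_def)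
      then have "(1 + norm x) powr (-p) \<le> (2 ^ m) powr (-p)"
        using p by (intro powr_mono2') auto
      also have "\<dots> = 2 powr (real m * (-p))" by (simp add: powr_realpow[symmetric] powr_powr)
      also have "\<dots> = ?a k" by (simp add: Suc powr_add[symmetric] algebra_simps)
      finally show ?thesis .
    qed
    then have "ennreal ((1 + norm x) powr (-p)) \<le> (\<Sum>i\<in>{k}. ennreal (?a i) * indicator (cball 0 (2 ^ i)) x)"
      using k by (simp add: ennreal_leI)
    also have "\<dots> \<le> (\<Sum>k. ennreal (?a k) * indicator (cball 0 (2 ^ k)) x)"
      by (intro sum_le_suminf) auto
    finally show ?thesis .
  qed
  have "(\<integral>\<^sup>+x. ennreal ((1 + norm (x::'a)) powr (-p)) \<partial>lebesgue)
      \<le> (\<integral>\<^sup>+x. (\<Sum>k. ennreal (?a k) * indicator (cball (0::'a) (2 ^ k)) x) \<partial>lebesgue)"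
    by (intro nn_integral_mono bound)
  also have "\<dots> = (\<Sum>k. ennreal (?a k) * emeasure lebesgue (cball (0::'a) (2 ^ k)))"
  proof -
    have B: "cball (0::'a) r \<in> sets lebesgue" for r by simp
    have "(\<integral>\<^sup>+x. (\<Sum>k. ennreal (?a k) * indicator (cball (0::'a) (2 ^ k)) x) \<partial>lebesgue)
        = (\<Sum>k. \<integral>\<^sup>+x. ennreal (?a k) * indicator (cball (0::'a) (2 ^ k)) x \<partial>lebesgue)"
      by (rule nn_integral_suminf) (rule borel_measurable_times_ennreal[OF measurable_const borel_measurable_indicator[OF B]], simp)
    then show ?thesis by (simp only: nn_integral_cmult_indicator[OF B])
  qed
  also have "\<dots> = (\<Sum>k. ennreal (2 powr p * ?V * (2 powr (real ?N - p)) ^ k))"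
  proof (intro suminf_cong)
    fix k
    have "2 powr (- p * real k) * (2 ^ k) ^ ?N = (2 powr (real ?N - p)) ^ k"
    proof -
      have "((2::real) ^ k) ^ ?N = 2 powr (real k * real ?N)"
        by (simp add: powr_realpow[symmetric] powr_powr)
      moreover have "(2 powr (real ?N - p)) ^ k = 2 powr (real k * (real ?N - p))"
        by (simp add: powr_power mult.commute)
      ultimately show ?thesis by (simp add: powr_add[symmetric] algebra_simps)
    qed
    then show "ennreal (?a k) * emeasure lebesgue (cball (0::'a) (2 ^ k)) = ennreal (2 powr p * ?V * (2 powr (real ?N - p)) ^ k)"
      by (simp add: emeasure_cball ennreal_mult[symmetric] mult_ac)
  qed
  also have "\<dots> < top"
  proof -
    have "2 powr (real ?N - p) < 1" using p powr_less_mono[of "real ?N - p" 0 2] by simp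
    then have "summable (\<lambda>k. 2 powr p * ?V * (2 powr (real ?N - p)) ^ k)"
      by (intro summable_mult summable_geometric) simp
    then have "(\<Sum>k. ennreal (2 powr p * ?V * (2 powr (real ?N - p)) ^ k)) \<noteq> top"
      by (rule ennreal_suminf_neq_top) simp
    then show ?thesis by (simp add: less_top)
  qed
  finally show ?thesis .
qed

section \<open>Pointwise inequalities for concave powers\<close>

lemma powr_le_linear_weight:
  fixes t s q :: real
  assumes "0 \<le> t" "0 < s" "0 < q" "q < 1"
  shows "t powr q \<le> s powr (q - 1) * t + s powr q"
proof (cases "s \<le> t")
  case True
  then have "t powr q = t powr (q - 1) * t" using assms by (simp add: powr_mult_base[symmetric] powr_diff)
  also have "\<dots> \<le> s powr (q - 1) * t" using assms True by (intro mult_right_mono powr_mono2') auto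
  finally show ?thesis by (simp add: add_increasing2)
next
  case False
  then have "t powr q \<le> s powr q" using assms by (intro powr_mono2) auto
  then show ?thesis using assms by (simp add: add_increasing)
qed

text \<open>Above the height \<open>k\<close> the power is at most linear with slope
  \<open>k powr (q - 1)\<close>. After integration the cost of truncating is this slope times the
  mass, which vanishes for large \<open>k\<close>.\<close>

lemma powr_le_truncation:
  fixes t k q :: real
  assumes "0 \<le> t" "0 < k" "0 < q" "q < 1"
  shows "t powr q \<le> (min t k) powr q + k powr (q - 1) * t"
proof (cases "k \<le> t")
  case True
  then have "t powr q = t powr (q - 1) * t" using assms by (simp add: powr_mult_base[symmetric] powr_diff)
  also have "\<dots> \<le> k powr (q - 1) * t" using assms True by (intro mult_right_mono powr_mono2') auto
  finally show ?thesis by (simp add: add_increasing)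
qed (use assms in \<open>simp add: min_def\<close>)

text \<open>Concavity: the graph lies below its tangent at \<open>a\<close>, obtained from Young's
  inequality. The terms are arranged without subtraction so that the inequality transfers to
  \<open>ennreal\<close>.\<close>

lemma powr_tangent:
  fixes t a q :: real
  assumes "0 \<le> t" "0 < a" "0 < q" "q < 1"
  shows "t powr q + q * a powr (q - 1) * a \<le> a powr q + q * a powr (q - 1) * t"
proof (cases "t = 0")
  case True
  have "a powr q = a powr (q - 1) * a" using assms by (simp add: powr_diff)
  then show ?thesis using True assms mult_right_mono[of q 1 "a powr (q - 1) * a"] by simp
next
  case False
  then have "t powr q * a powr (1 - q) \<le> q * t + (1 - q) * a"
    using assms by (intro Youngs_inequality_0) auto
  then have "a powr (q - 1) * (t powr q * a powr (1 - q)) \<le> a powr (q - 1) * (q * t + (1 - q) * a)"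
    by (intro mult_left_mono) auto
  moreover have "a powr (q - 1) * (t powr q * a powr (1 - q)) = t powr q * (a powr (q - 1) * a powr (1 - q))" by simp
  moreover have "a powr (q - 1) * a powr (1 - q) = 1" using assms by (simp add: powr_add[symmetric])
  moreover have "a powr q = a powr (q - 1) * a" using assms by (simp add: powr_diff)
  ultimately show ?thesis by (simp add: algebra_simps)
qed

text \<open>Since \<open>q - 1\<close> is negative, each summand \<open>x\<close> satisfies
  \<open>x * (a + b) powr (q - 1) \<le> x powr q\<close>; adding the two cases gives the
  claim.\<close>

lemma powr_subadditive:
  fixes a b q :: real
  assumes "0 \<le> a" "0 < b" "0 < q" "q < 1"
  shows "(a + b) powr q \<le> a powr q + b powr q"
proof -
  have *: "x * (a + b) powr (q - 1) \<le> x powr q" if "0 \<le> x" "x \<le> a + b" for x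
  proof (cases "x = 0")
    case False
    then have "(a + b) powr (q - 1) \<le> x powr (q - 1)" using that assms by (intro powr_mono2') auto
    then have "x * (a + b) powr (q - 1) \<le> x * x powr (q - 1)" using that by (intro mult_left_mono) auto
    then show ?thesis using False that by (simp add: powr_diff)
  qed simp
  have "(a + b) powr q = (a + b) * (a + b) powr (q - 1)"
    using assms by (simp add: powr_diff)
  then have "(a + b) powr q = a * (a + b) powr (q - 1) + b * (a + b) powr (q - 1)"
    by (simp add: distrib_right)
  with *[of a] *[of b] assms show ?thesis by linarith
qed

text \<open>The tangent inequality at \<open>h x + e\<close> bounds the power of \<open>f j\<close>
  by an expression linear in \<open>f j\<close>, to which \<open>weak_bounded\<close> applies. The
  error is \<open>e powr q\<close> times the volume of the ball and vanishes with
  \<open>e\<close>.\<close>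

lemma (in ultralimit) weak_limit_powr_upper:
  fixes f :: "nat \<Rightarrow> 'a::euclidean_space \<Rightarrow> real" and h :: "'a \<Rightarrow> real"
  assumes wl: "weak_limit G lebesgue (\<lambda>j x. ennreal (f j x)) (\<lambda>x. ennreal (h x))"
    and [measurable]: "\<And>j. f j \<in> borel_measurable lebesgue" "h \<in> borel_measurable lebesgue"
    and f0: "\<And>j x. 0 \<le> f j x" and h0: "\<And>x. 0 \<le> h x" and q: "0 < q" "q < 1"
  shows "L (\<lambda>j. \<integral>\<^sup>+x. ennreal (f j x powr q) * indicator (cball 0 R) x \<partial>lebesgue)
    \<le> (\<integral>\<^sup>+x. ennreal (h x powr q) \<partial>lebesgue)"
proof -
  interpret weak_limit G lebesgue "\<lambda>j x. ennreal (f j x)" "\<lambda>x. ennreal (h x)" by fact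
  let ?I = "indicator (cball (0::'a) R) :: 'a \<Rightarrow> ennreal"
  let ?Lf = "L (\<lambda>j. \<integral>\<^sup>+x. ennreal (f j x powr q) * ?I x \<partial>lebesgue)"
  let ?H = "\<integral>\<^sup>+x. ennreal (h x powr q) \<partial>lebesgue"
  have B[measurable]: "cball (0::'a) R \<in> sets lebesgue" by simp
  have [measurable]: "?I \<in> borel_measurable lebesgue" by (rule borel_measurable_indicator[OF B])
  have step: "?Lf \<le> ?H + ennreal (e powr q) * emeasure lebesgue (cball (0::'a) R)" if e: "0 < e" for e
  proof -
    \<comment> \<open>The slope of the tangent; the shift by \<open>e\<close> keeps it bounded where
      \<open>h\<close> vanishes.\<close>
    let ?\<phi> = "\<lambda>x. ennreal (q * (h x + e) powr (q - 1)) * ?I x"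
    have phi_meas: "?\<phi> \<in> borel_measurable lebesgue" by measurable
    have phi_le: "?\<phi> x \<le> ennreal (q * e powr (q - 1))" for x
      using h0[of x] e q by (auto split: split_indicator intro!: ennreal_leI mult_left_mono powr_mono2')
    have pt: "ennreal (f j x powr q) * ?I x + ennreal (h x) * ?\<phi> x
        \<le> (ennreal (h x powr q) + ennreal (e powr q)) * ?I x + ennreal (f j x) * ?\<phi> x" for j x
    proof -
      have "f j x powr q + q * (h x + e) powr (q - 1) * (h x + e) \<le> (h x + e) powr q + q * (h x + e) powr (q - 1) * f j x"
        using f0[of j x] h0[of x] e q by (intro powr_tangent) auto
      moreover have "(h x + e) powr q \<le> h x powr q + e powr q"
        using h0[of x] e q by (intro powr_subadditive) auto
      moreover have "q * (h x + e) powr (q - 1) * h x \<le> q * (h x + e) powr (q - 1) * (h x + e)"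
        using e q by (intro mult_left_mono) auto
      ultimately have "f j x powr q + h x * (q * (h x + e) powr (q - 1)) \<le> h x powr q + e powr q + f j x * (q * (h x + e) powr (q - 1))"
        by (simp add: mult_ac)
      then show ?thesis
        using f0[of j x] h0[of x] e q
        by (auto simp: ennreal_plus[symmetric] ennreal_mult[symmetric] simp del: ennreal_plus split: split_indicator intro!: ennreal_leI)
    qed
    have "?Lf + (\<integral>\<^sup>+x. ennreal (h x) * ?\<phi> x \<partial>lebesgue)
        = L (\<lambda>j. \<integral>\<^sup>+x. ennreal (f j x powr q) * ?I x + ennreal (h x) * ?\<phi> x \<partial>lebesgue)"
      by (subst nn_integral_add) (measurable, simp add: L_add)
    also have "\<dots> \<le> L (\<lambda>j. \<integral>\<^sup>+x. (ennreal (h x powr q) + ennreal (e powr q)) * ?I x + ennreal (f j x) * ?\<phi> x \<partial>lebesgue)"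
      by (intro L_mono nn_integral_mono pt)
    also have "\<dots> = (\<integral>\<^sup>+x. (ennreal (h x powr q) + ennreal (e powr q)) * ?I x \<partial>lebesgue) + (\<integral>\<^sup>+x. ennreal (h x) * ?\<phi> x \<partial>lebesgue)"
      by (subst nn_integral_add) (measurable, simp add: L_add weak_bounded[OF phi_meas phi_le])
    finally have "?Lf \<le> (\<integral>\<^sup>+x. (ennreal (h x powr q) + ennreal (e powr q)) * ?I x \<partial>lebesgue)"
    proof (rule ennreal_add_right_cancel_leD)
      have "(\<integral>\<^sup>+x. ennreal (h x) * ?\<phi> x \<partial>lebesgue) \<le> (\<integral>\<^sup>+x. ennreal (h x) * ennreal (q * e powr (q - 1)) \<partial>lebesgue)"
        by (intro nn_integral_mono mult_left_mono phi_le) simp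
      also have "\<dots> = (\<integral>\<^sup>+x. ennreal (h x) \<partial>lebesgue) * ennreal (q * e powr (q - 1))"
        by (rule nn_integral_multc) measurable
      also have "\<dots> < top" using h_fin by (simp add: ennreal_mult_less_top)
      finally show "(\<integral>\<^sup>+x. ennreal (h x) * ?\<phi> x \<partial>lebesgue) < top" .
    qed
    also have "\<dots> = (\<integral>\<^sup>+x. ennreal (h x powr q) * ?I x \<partial>lebesgue) + (\<integral>\<^sup>+x. ennreal (e powr q) * ?I x \<partial>lebesgue)"
      unfolding distrib_right by (rule nn_integral_add) measurable
    also have "\<dots> \<le> ?H + ennreal (e powr q) * emeasure lebesgue (cball (0::'a) R)"
      unfolding nn_integral_cmult_indicator[OF B]
      by (intro add_right_mono nn_integral_mono) (auto split: split_indicator)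
    finally show ?thesis .
  qed
  have fin: "emeasure lebesgue (cball (0::'a) R) < top"
    using emeasure_bounded_finite[of "cball (0::'a) R"] by (simp add: less_top)
  have "(\<lambda>n. (1 / real (Suc n)) powr q) \<longlonglongrightarrow> 0 powr q"
    using q LIMSEQ_inverse_real_of_nat by (intro tendsto_powr') (auto simp: inverse_eq_divide)
  then have "(\<lambda>n. ennreal ((1 / real (Suc n)) powr q)) \<longlonglongrightarrow> 0"
    using tendsto_ennrealI by fastforce
  then have "(\<lambda>n. ?H + emeasure lebesgue (cball (0::'a) R) * ennreal ((1 / real (Suc n)) powr q)) \<longlonglongrightarrow> ?H + emeasure lebesgue (cball (0::'a) R) * 0"
    by (intro tendsto_add tendsto_const ennreal_tendsto_cmult fin)
  moreover have "?Lf \<le> ?H + emeasure lebesgue (cball (0::'a) R) * ennreal ((1 / real (Suc n)) powr q)" for n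
    using step[of "1 / real (Suc n)"] by (simp add: mult.commute)
  ultimately show ?thesis
    using LIMSEQ_le_const by (metis (no_types, lifting) add.right_neutral mult_zero_right)
qed

section \<open>Uniform control of the tails and passage to the limit\<close>

lemma nn_integral_weight_tail:
  assumes p: "real DIM('a::euclidean_space) < p"
  shows "(\<lambda>R. \<integral>\<^sup>+x. ennreal ((1 + norm (x::'a)) powr (-p)) * indicator (- cball 0 (real R)) x \<partial>lebesgue) \<longlonglongrightarrow> 0"
proof -
  have [measurable]: "(indicator (- cball 0 (real R)) :: 'a \<Rightarrow> ennreal) \<in> borel_measurable lebesgue" for R :: nat
    by (rule borel_measurable_indicator) simp
  have "(\<lambda>R. \<integral>\<^sup>+x. ennreal ((1 + norm (x::'a)) powr (-p)) * indicator (- cball 0 (real R)) x \<partial>lebesgue)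
      \<longlonglongrightarrow> (\<integral>\<^sup>+x. 0 \<partial>(lebesgue :: 'a measure))"
  proof (rule nn_integral_dominated_convergence[where w="\<lambda>x. ennreal ((1 + norm (x::'a)) powr (-p))"])
    show "AE x in lebesgue. (\<lambda>R. ennreal ((1 + norm (x::'a)) powr (-p)) * indicator (- cball 0 (real R)) x) \<longlonglongrightarrow> 0"
    proof (rule AE_I2)
      fix x :: 'a
      obtain n :: nat where n: "norm x \<le> real n" using real_arch_simple by blast
      have "eventually (\<lambda>R::nat. ennreal ((1 + norm x) powr (-p)) * indicator (- cball 0 (real R)) x = 0) sequentially"
        using n by (intro eventually_sequentiallyI[of n]) (auto split: split_indicator)
      then show "(\<lambda>R::nat. ennreal ((1 + norm x) powr (-p)) * indicator (- cball 0 (real R)) x) \<longlonglongrightarrow> 0"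
        by (rule tendsto_eventually)
    qed
  qed (use nn_integral_weight_finite[OF p] in \<open>auto split: split_indicator\<close>)
  then show ?thesis by simp
qed

text \<open>This is \<open>powr_le_linear_weight\<close> with a threshold \<open>s\<close> depending
  on \<open>x\<close>, chosen so that \<open>s powr (q - 1)\<close> produces the moment weight. The
  remaining power of \<open>1 + norm x\<close> is integrable exactly when
  \<open>l * q / (1 - q)\<close> exceeds the dimension.\<close>

lemma powr_moment_bound:
  fixes x :: "'a::euclidean_space"
  assumes "0 \<le> t" "0 < K" "0 < q" "q < 1"
  shows "t powr q \<le> K powr (q - 1) * ((1 + norm x) powr l * t) + K powr q * (1 + norm x) powr (- (l * q / (1 - q)))"
proof -
  define s where "s = K * (1 + norm x) powr (- (l / (1 - q)))"
  have n: "0 < 1 + norm x" by (simp add: add_pos_nonneg)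
  have e: "- (l / (1 - q)) * (q - 1) = l" "- (l / (1 - q)) * q = - (l * q / (1 - q))"
    using assms by (auto simp: field_simps)
  have "s powr a = K powr a * (1 + norm x) powr (- (l / (1 - q)) * a)" for a
    using assms n by (simp add: s_def powr_mult powr_powr)
  from this[of "q - 1"] this[of q]
  have "s powr (q - 1) = K powr (q - 1) * (1 + norm x) powr l"
    "s powr q = K powr q * (1 + norm x) powr (- (l * q / (1 - q)))"
    by (simp_all only: e)
  moreover have "t powr q \<le> s powr (q - 1) * t + s powr q"
    using assms n by (intro powr_le_linear_weight) (auto simp: s_def)
  ultimately show ?thesis by (simp add: mult_ac)
qed

text \<open>The integral of \<open>r j powr q\<close> splits into the truncated part on a ball of
  radius \<open>R\<close>, the truncation error, and a tail controlled by the moment with parameter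
  \<open>K\<close>. Only the first part survives when \<open>R\<close> and then \<open>K\<close>
  tend to infinity, and \<open>weak_limit_powr_upper\<close> bounds it by the integral of
  \<open>h powr q\<close>.\<close>

lemma (in ultralimit) weak_limit_powr_lower:
  fixes r :: "nat \<Rightarrow> 'a::euclidean_space \<Rightarrow> real" and h :: "'a \<Rightarrow> real" and \<kappa> :: "nat \<Rightarrow> nat"
  defines "f \<equiv> \<lambda>j x. min (r j x) (real (\<kappa> j) * indicator (cball 0 (real (\<kappa> j))) x)"
  assumes wl: "weak_limit G lebesgue (\<lambda>j x. ennreal (f j x)) (\<lambda>x. ennreal (h x))"
    and r[measurable]: "\<And>j. r j \<in> borel_measurable lebesgue" and h[measurable]: "h \<in> borel_measurable lebesgue"
    and r0: "\<And>j x. 0 \<le> r j x" and h0: "\<And>x. 0 \<le> h x"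
    and l: "0 < l" and q: "real DIM('a) / (real DIM('a) + l) < q" "q < 1"
    and mass: "\<And>j. (\<integral>\<^sup>+x. ennreal (r j x) \<partial>lebesgue) \<le> 1"
    and moment: "\<And>j. (\<integral>\<^sup>+x. ennreal ((1 + norm x) powr l * r j x) \<partial>lebesgue) \<le> ennreal B"
    and powr1: "\<And>j. 1 \<le> (\<integral>\<^sup>+x. ennreal (r j x powr q) \<partial>lebesgue)"
    and kappa: "\<And>k. eventually (\<lambda>j. k \<le> \<kappa> j) G"
  shows "1 \<le> (\<integral>\<^sup>+x. ennreal (h x powr q) \<partial>lebesgue)"
proof -
  define p where "p = l * q / (1 - q)"
  have q0: "0 < q" by (rule le_less_trans[OF _ q(1)]) (use l in simp)
  \<comment> \<open>This is the lower bound on \<open>q\<close>, rearranged.\<close>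
  have p: "real DIM('a) < p"
  proof -
    have "real DIM('a) < q * (real DIM('a) + l)" using q(1) l by (simp add: pos_divide_less_eq)
    then show ?thesis using q by (simp add: p_def pos_less_divide_eq algebra_simps)
  qed
  let ?w = "\<lambda>x::'a. (1 + norm x) powr (-p)"
  let ?H = "\<integral>\<^sup>+x. ennreal (h x powr q) \<partial>lebesgue"
  let ?T = "\<lambda>R::nat. \<integral>\<^sup>+x. ennreal (?w x) * indicator (- cball 0 (real R)) x \<partial>lebesgue"
  have [measurable]: "(indicator (cball 0 R) :: 'a \<Rightarrow> ennreal) \<in> borel_measurable lebesgue"
      "(indicator (cball 0 R) :: 'a \<Rightarrow> real) \<in> borel_measurable lebesgue"
      "(indicator (- cball 0 R) :: 'a \<Rightarrow> ennreal) \<in> borel_measurable lebesgue" for R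
    by (rule borel_measurable_indicator, simp)+
  have f0: "0 \<le> f j x" for j x using r0 by (simp add: f_def)
  have fm[measurable]: "f j \<in> borel_measurable lebesgue" for j unfolding f_def by measurable
  have step: "1 \<le> ?H + ennreal (real R powr (q - 1)) + ennreal (K powr (q - 1)) * ennreal B + ennreal (K powr q) * ?T R"
    if R: "0 < R" and K: "0 < K" for R :: nat and K :: real
  proof -
    have pt: "ennreal (r j x powr q) \<le> ennreal (f j x powr q) * indicator (cball 0 (real R)) x
        + (ennreal (real R powr (q - 1)) * ennreal (r j x)
        + (ennreal (K powr (q - 1)) * ennreal ((1 + norm x) powr l * r j x)
        + ennreal (K powr q) * (ennreal (?w x) * indicator (- cball 0 (real R)) x)))" if k: "R \<le> \<kappa> j" for j x
    \<comment> \<open>Inside the ball only the cut in height acts, because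
      \<open>R \<le> \<kappa> j\<close>; outside it the moment bound takes over.\<close>
    proof (cases "x \<in> cball 0 (real R)")
      case True
      then have "f j x = min (r j x) (real (\<kappa> j))" using k by (auto simp: f_def)
      then have "r j x powr q \<le> f j x powr q + real (\<kappa> j) powr (q - 1) * r j x"
        using powr_le_truncation[of "r j x" "real (\<kappa> j)" q] r0 R k q0 q by simp
      also have "\<dots> \<le> f j x powr q + real R powr (q - 1) * r j x"
        using k R q r0 by (intro add_left_mono mult_right_mono powr_mono2') auto
      finally have "ennreal (r j x powr q) \<le> ennreal (f j x powr q) + ennreal (real R powr (q - 1)) * ennreal (r j x)"
        using r0[of j x] by (simp add: ennreal_mult[symmetric] ennreal_plus[symmetric] ennreal_leI del: ennreal_plus)
      then show ?thesis using True by (simp add: add.assoc[symmetric] add_increasing2)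
    next
      case False
      have "ennreal (r j x powr q) \<le> ennreal (K powr (q - 1)) * ennreal ((1 + norm x) powr l * r j x) + ennreal (K powr q) * ennreal (?w x)"
        using powr_moment_bound[of "r j x" K q x l] r0[of j x] K q0 q
        by (simp add: p_def ennreal_mult[symmetric] ennreal_plus[symmetric] ennreal_leI del: ennreal_plus)
      then show ?thesis using False by (simp add: add_increasing)
    qed
    have "L (\<lambda>_. 1) \<le> L (\<lambda>j. (\<integral>\<^sup>+x. ennreal (f j x powr q) * indicator (cball 0 (real R)) x \<partial>lebesgue)
        + (ennreal (real R powr (q - 1)) + (ennreal (K powr (q - 1)) * ennreal B + ennreal (K powr q) * ?T R)))"
    proof (rule L_mono_ev, rule eventually_mono[OF kappa[of R]])
      fix j assume k: "R \<le> \<kappa> j"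
      have "1 \<le> (\<integral>\<^sup>+x. ennreal (r j x powr q) \<partial>lebesgue)" by (rule powr1)
      also have "\<dots> \<le> (\<integral>\<^sup>+x. ennreal (f j x powr q) * indicator (cball 0 (real R)) x
        + (ennreal (real R powr (q - 1)) * ennreal (r j x)
        + (ennreal (K powr (q - 1)) * ennreal ((1 + norm x) powr l * r j x)
        + ennreal (K powr q) * (ennreal (?w x) * indicator (- cball 0 (real R)) x))) \<partial>lebesgue)"
        by (intro nn_integral_mono pt k)
      also have "\<dots> = (\<integral>\<^sup>+x. ennreal (f j x powr q) * indicator (cball 0 (real R)) x \<partial>lebesgue)
        + (ennreal (real R powr (q - 1)) * (\<integral>\<^sup>+x. ennreal (r j x) \<partial>lebesgue)
        + (ennreal (K powr (q - 1)) * (\<integral>\<^sup>+x. ennreal ((1 + norm x) powr l * r j x) \<partial>lebesgue)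
        + ennreal (K powr q) * ?T R))"
        by (simp add: nn_integral_add nn_integral_cmult)
      also have "\<dots> \<le> (\<integral>\<^sup>+x. ennreal (f j x powr q) * indicator (cball 0 (real R)) x \<partial>lebesgue)
        + (ennreal (real R powr (q - 1)) * 1 + (ennreal (K powr (q - 1)) * ennreal B + ennreal (K powr q) * ?T R))"
        by (rule add_left_mono, rule add_mono[OF mult_left_mono[OF mass] add_right_mono[OF mult_left_mono[OF moment]]]) simp_all
      finally show "1 \<le> (\<integral>\<^sup>+x. ennreal (f j x powr q) * indicator (cball 0 (real R)) x \<partial>lebesgue)
        + (ennreal (real R powr (q - 1)) + (ennreal (K powr (q - 1)) * ennreal B + ennreal (K powr q) * ?T R))"
        by (simp only: mult_1_right)
    qed
    also have "\<dots> \<le> ?H + (ennreal (real R powr (q - 1)) + (ennreal (K powr (q - 1)) * ennreal B + ennreal (K powr q) * ?T R))"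
      unfolding L_add L_const by (intro add_right_mono weak_limit_powr_upper[OF wl fm h f0 h0 q0 q(2)])
    finally show ?thesis by (simp only: add.assoc L_const)
  qed
  have pow0: "(\<lambda>n. ennreal (real n powr (q - 1))) \<longlonglongrightarrow> 0"
  proof -
    have "(\<lambda>n. real n powr (q - 1)) \<longlonglongrightarrow> 0"
      using q by (intro tendsto_neg_powr filterlim_real_sequentially) auto
    from tendsto_ennrealI[OF this] show ?thesis by simp
  qed
  \<comment> \<open>For fixed \<open>K\<close>, letting \<open>R\<close> grow removes the truncation
    error and the weight tail; the moment term is left for the limit in \<open>K\<close>.\<close>
  have stepK: "1 \<le> ?H + ennreal (K powr (q - 1)) * ennreal B" if K: "0 < K" for K :: real
  proof -
    have "(\<lambda>R. ?H + ennreal (real R powr (q - 1)) + ennreal (K powr (q - 1)) * ennreal B + ennreal (K powr q) * ?T R)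
      \<longlonglongrightarrow> ?H + 0 + ennreal (K powr (q - 1)) * ennreal B + ennreal (K powr q) * 0"
      by (intro tendsto_add tendsto_const ennreal_tendsto_cmult pow0 nn_integral_weight_tail p) simp
    then have "1 \<le> ?H + 0 + ennreal (K powr (q - 1)) * ennreal B + ennreal (K powr q) * 0"
      by (rule LIMSEQ_le_const) (use step[OF _ K] in \<open>auto intro!: exI[of _ 1]\<close>)
    then show ?thesis by simp
  qed
  have "(\<lambda>n. ?H + ennreal B * ennreal (real n powr (q - 1))) \<longlonglongrightarrow> ?H + ennreal B * 0"
    by (intro tendsto_add tendsto_const ennreal_tendsto_cmult pow0) simp
  then have "1 \<le> ?H + ennreal B * 0"
  proof (rule LIMSEQ_le_const, intro exI[of _ 1] allI impI)
    fix n :: nat assume "1 \<le> n"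
    then show "1 \<le> ?H + ennreal B * ennreal (real n powr (q - 1))"
      using stepK[of "real n"] by (simp add: mult.commute)
  qed
  then show ?thesis by simp
qed

section \<open>Compactness\<close>

lemma powr_add_le:
  fixes a b l :: real
  assumes "0 \<le> a" "0 \<le> b" "0 < l"
  shows "(a + b) powr l \<le> 2 powr l * (a powr l + b powr l)"
proof -
  have *: "(x + y) powr l \<le> 2 powr l * (x powr l + y powr l)" if "0 \<le> x" "x \<le> y" for x y :: real
  proof -
    have "(x + y) powr l \<le> (2 * y) powr l" using that assms by (intro powr_mono2) auto
    also have "\<dots> \<le> 2 powr l * (x powr l + y powr l)"
      using that by (simp add: powr_mult mult_left_mono)
    finally show ?thesis .
  qed
  show ?thesis using *[of a b] *[of b a] assms by (cases "a \<le> b") (auto simp: add.commute)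
qed

text \<open>Turns bounds on the mass and on the potential at the origin into the weighted moment
  bound that controls the tails.\<close>

lemma weighted_mass_le:
  fixes u :: "'a::euclidean_space \<Rightarrow> ennreal"
  assumes [measurable]: "u \<in> borel_measurable lebesgue" and l: "0 < l"
  shows "(\<integral>\<^sup>+x. u x * ennreal ((1 + norm x) powr l) \<partial>lebesgue)
    \<le> ennreal (2 powr l) * ((\<integral>\<^sup>+x. u x \<partial>lebesgue) + pot lebesgue (ker l) u 0)"
proof -
  have "u x * ennreal ((1 + norm x) powr l) \<le> ennreal (2 powr l) * (u x + u x * ker l x 0)" for x
  proof -
    have "ennreal ((1 + norm x) powr l) \<le> ennreal (2 powr l) * (1 + ker l x 0)"
      using powr_add_le[of 1 "norm x" l] l
      by (simp add: ker_def ennreal_1[symmetric] ennreal_plus[symmetric] ennreal_mult[symmetric] ennreal_leI del: ennreal_1 ennreal_plus)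
    then have "u x * ennreal ((1 + norm x) powr l) \<le> u x * (ennreal (2 powr l) * (1 + ker l x 0))"
      by (rule mult_left_mono) simp
    then show ?thesis by (simp add: distrib_left mult_ac)
  qed
  then have "(\<integral>\<^sup>+x. u x * ennreal ((1 + norm x) powr l) \<partial>lebesgue)
      \<le> (\<integral>\<^sup>+x. ennreal (2 powr l) * (u x + u x * ker l x 0) \<partial>lebesgue)"
    by (rule nn_integral_mono)
  also have "\<dots> = ennreal (2 powr l) * ((\<integral>\<^sup>+x. u x \<partial>lebesgue) + pot lebesgue (ker l) u 0)"
    unfolding pot_def by (subst nn_integral_cmult) (auto simp: nn_integral_add)
  finally show ?thesis .
qed

text \<open>The triangle inequality integrated against \<open>u\<close>. It keeps points of bounded
  potential in a bounded set as long as the mass stays away from 0.\<close>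

lemma mass_powr_le_pot:
  fixes u :: "'a::euclidean_space \<Rightarrow> ennreal"
  assumes [measurable]: "u \<in> borel_measurable lebesgue" and l: "0 < l"
  shows "ennreal (norm y powr l) * (\<integral>\<^sup>+x. u x \<partial>lebesgue)
    \<le> ennreal (2 powr l) * (pot lebesgue (ker l) u y + pot lebesgue (ker l) u 0)"
proof -
  have "ennreal (norm y powr l) * u x \<le> ennreal (2 powr l) * (u x * ker l x y + u x * ker l x 0)" for x
  proof -
    have "norm y powr l \<le> (norm (x - y) + norm x) powr l"
      using norm_triangle_ineq[of "y - x" x] l by (intro powr_mono2) (auto simp: norm_minus_commute)
    also have "\<dots> \<le> 2 powr l * (norm (x - y) powr l + norm x powr l)"
      using l by (intro powr_add_le) auto
    finally have "ennreal (norm y powr l) \<le> ennreal (2 powr l) * (ker l x y + ker l x 0)"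
      by (simp add: ker_def ennreal_plus[symmetric] ennreal_mult[symmetric] ennreal_leI del: ennreal_plus)
    then have "u x * ennreal (norm y powr l) \<le> u x * (ennreal (2 powr l) * (ker l x y + ker l x 0))"
      by (rule mult_left_mono) simp
    then show ?thesis by (simp add: distrib_left mult_ac)
  qed
  then have "(\<integral>\<^sup>+x. ennreal (norm y powr l) * u x \<partial>lebesgue)
      \<le> (\<integral>\<^sup>+x. ennreal (2 powr l) * (u x * ker l x y + u x * ker l x 0) \<partial>lebesgue)"
    by (rule nn_integral_mono)
  also have "\<dots> = ennreal (2 powr l) * (pot lebesgue (ker l) u y + pot lebesgue (ker l) u 0)"
    unfolding pot_def by (subst nn_integral_cmult) (auto simp: nn_integral_add)
  finally show ?thesis by (simp add: nn_integral_cmult)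
qed

text \<open>The Dirac mass \<open>m j\<close> sits at \<open>z j\<close>, and the limit mass
  \<open>M\<close> at \<open>y\<close> collects all that \<open>h\<close> does not retain, so the
  total stays 1. The \<open>q\<close>-integral may exceed 1, which can only lower the
  quotient.\<close>

lemma compactness:
  fixes r :: "nat \<Rightarrow> 'a::euclidean_space \<Rightarrow> real" and m :: "nat \<Rightarrow> real" and z :: "nat \<Rightarrow> 'a"
  assumes r[measurable]: "\<And>j. r j \<in> borel_measurable lebesgue" and r0: "\<And>j x. 0 \<le> r j x"
    and m0: "\<And>j. 0 \<le> m j"
    and l: "0 < l" and q: "real DIM('a) / (real DIM('a) + l) < q" "q < 1"
    and mass: "\<And>j. (\<integral>\<^sup>+x. ennreal (r j x) \<partial>lebesgue) + ennreal (m j) = 1"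
    and powr1: "\<And>j. (\<integral>\<^sup>+x. ennreal (r j x powr q) \<partial>lebesgue) = 1"
    and pot0: "\<And>j. pot lebesgue (ker l) (\<lambda>x. ennreal (r j x)) 0 \<le> ennreal B"
    and en: "\<And>j. bilin lebesgue (ker l) (\<lambda>x. ennreal (r j x)) (\<lambda>x. ennreal (r j x))
        + 2 * ennreal (m j) * pot lebesgue (ker l) (\<lambda>x. ennreal (r j x)) (z j) \<le> c j"
    and c: "c \<longlonglongrightarrow> C"
  shows "\<exists>(h :: 'a \<Rightarrow> real) M y. h \<in> borel_measurable lebesgue \<and> (\<forall>x. 0 \<le> h x) \<and> 0 \<le> M \<and>
    (\<integral>\<^sup>+x. ennreal (h x) \<partial>lebesgue) + ennreal M = 1 \<and>
    1 \<le> (\<integral>\<^sup>+x. ennreal (h x powr q) \<partial>lebesgue) \<and> (\<integral>\<^sup>+x. ennreal (h x powr q) \<partial>lebesgue) < top \<and>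
    bilin lebesgue (ker l) (\<lambda>x. ennreal (h x)) (\<lambda>x. ennreal (h x))
        + 2 * ennreal M * pot lebesgue (ker l) (\<lambda>x. ennreal (h x)) y \<le> C"
proof -
  obtain G where "ultra G" using ultra_exists by blast
  interpret ultralimit G by unfold_locales fact
  have q0: "0 < q" by (rule le_less_trans[OF _ q(1)]) (use l in simp)
  have [measurable]: "(indicator (cball 0 R) :: 'a \<Rightarrow> real) \<in> borel_measurable lebesgue" for R
    by (rule borel_measurable_indicator) simp
  have mass1: "(\<integral>\<^sup>+x. ennreal (r j x) \<partial>lebesgue) \<le> 1" for j
    using mass[of j] by (metis add_increasing2 order_refl zero_le)
  \<comment> \<open>One index bounds both the height and the radius of the truncation.\<close>
  define \<psi> :: "nat \<Rightarrow> 'a \<Rightarrow> real" where "\<psi> k x = real k * indicator (cball 0 (real k)) x" for k x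
  have psi_meas[measurable]: "\<psi> k \<in> borel_measurable lebesgue" for k unfolding \<psi>_def by measurable
  have psi0: "0 \<le> \<psi> k x" for k x by (simp add: \<psi>_def)
  have psi_fin: "(\<integral>\<^sup>+x. ennreal (\<psi> k x) \<partial>lebesgue) < top" for k
  proof -
    have B: "cball (0::'a) (real k) \<in> sets lebesgue" by simp
    have "(\<integral>\<^sup>+x. ennreal (\<psi> k x) \<partial>lebesgue) = (\<integral>\<^sup>+x. ennreal (real k) * indicator (cball 0 (real k)) x \<partial>(lebesgue :: 'a measure))"
      by (intro nn_integral_cong) (auto simp: \<psi>_def split: split_indicator)
    also have "\<dots> = ennreal (real k) * emeasure lebesgue (cball (0::'a) (real k))"
      by (rule nn_integral_cmult_indicator[OF B])
    also have "\<dots> < top"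
      using emeasure_bounded_finite[of "cball (0::'a) (real k)"] by (simp add: ennreal_mult_less_top)
    finally show ?thesis .
  qed
  have "\<exists>\<kappa> h. (\<forall>k. eventually (\<lambda>j. k \<le> \<kappa> j) G) \<and> h \<in> borel_measurable lebesgue \<and> (\<forall>x. 0 \<le> h x) \<and>
    (\<forall>A\<in>sets lebesgue. L (\<lambda>j. \<integral>\<^sup>+x. min (ennreal (r j x)) (ennreal (\<psi> (\<kappa> j) x)) * indicator A x \<partial>lebesgue)
                = (\<integral>\<^sup>+x. ennreal (h x) * indicator A x \<partial>lebesgue))"
  proof (rule biting[OF sigma_finite_lebesgue])
    show "mono (\<lambda>k. ennreal (\<psi> k x))" for x
      by (intro monoI ennreal_leI) (auto simp: \<psi>_def split: split_indicator)
  qed (use mass1 psi_fin in auto)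
  then obtain \<kappa> h where kappa: "\<And>k. eventually (\<lambda>j. k \<le> \<kappa> j) G"
    and hm[measurable]: "h \<in> borel_measurable lebesgue" and h0: "\<And>x. 0 \<le> h x"
    and hw: "\<And>A. A \<in> sets lebesgue \<Longrightarrow> L (\<lambda>j. \<integral>\<^sup>+x. min (ennreal (r j x)) (ennreal (\<psi> (\<kappa> j) x)) * indicator A x \<partial>lebesgue)
                = (\<integral>\<^sup>+x. ennreal (h x) * indicator A x \<partial>lebesgue)"
    by blast
  define f where "f j x = min (r j x) (\<psi> (\<kappa> j) x)" for j x
  have fm[measurable]: "f j \<in> borel_measurable lebesgue" for j unfolding f_def by measurable
  have f0: "0 \<le> f j x" and fr: "f j x \<le> r j x" for j x
    using r0 psi0 by (auto simp: f_def)
  define g where "g j x = r j x - f j x" for j x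
  have g[measurable]: "g j \<in> borel_measurable lebesgue" for j unfolding g_def by measurable
  have g0: "0 \<le> g j x" for j x using fr by (simp add: g_def)
  have fg: "ennreal (r j x) = ennreal (f j x) + ennreal (g j x)" for j x
    using f0[of j x] g0[of j x] by (simp add: ennreal_plus[symmetric] g_def del: ennreal_plus)
  let ?V = "\<lambda>j. pot lebesgue (ker l) (\<lambda>x. ennreal (f j x))"
  have weakf: "L (\<lambda>j. \<integral>\<^sup>+x. ennreal (f j x) * indicator A x \<partial>lebesgue) = (\<integral>\<^sup>+x. ennreal (h x) * indicator A x \<partial>lebesgue)"
    if "A \<in> sets lebesgue" for A
  proof -
    have "ennreal (f j x) = min (ennreal (r j x)) (ennreal (\<psi> (\<kappa> j) x))" for j x
      using r0[of j x] psi0[of "\<kappa> j" x] by (auto simp: f_def min_def)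
    then show ?thesis using hw[OF that] by simp
  qed
  have mf: "(\<integral>\<^sup>+x. ennreal (f j x) \<partial>lebesgue) \<le> 1" for j
    by (rule order_trans[OF nn_integral_mono mass1[of j]]) (simp add: fr ennreal_leI)
  have "(\<integral>\<^sup>+x. ennreal (h x) \<partial>lebesgue) = L (\<lambda>j. \<integral>\<^sup>+x. ennreal (f j x) \<partial>lebesgue)"
    using weakf[of UNIV] by simp
  also have "\<dots> \<le> L (\<lambda>_. 1)" by (rule L_mono) (rule mf)
  finally have mh: "(\<integral>\<^sup>+x. ennreal (h x) \<partial>lebesgue) \<le> 1" by simp
  have wll: "weak_limit_lebesgue G (\<lambda>j x. ennreal (f j x)) (\<lambda>x. ennreal (h x)) l"
    by unfold_locales (use weakf mh l in \<open>auto simp: le_less_trans[OF mh]\<close>)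
  interpret weak_limit_lebesgue G "\<lambda>j x. ennreal (f j x)" "\<lambda>x. ennreal (h x)" l by (fact wll)
  have wl: "weak_limit G lebesgue (\<lambda>j x. ennreal (f j x)) (\<lambda>x. ennreal (h x))"
    by unfold_locales
  have V0: "?V j 0 \<le> ennreal B" for j
    by (rule order_trans[OF _ pot0[of j]]) (auto simp: pot_def intro!: nn_integral_mono mult_right_mono ennreal_leI fr)
  \<comment> \<open>The sign of \<open>B\<close> is not assumed, and \<open>ennreal\<close> sends
    negative reals to 0; the absolute value covers both cases.\<close>
  let ?B = "2 powr l * (1 + \<bar>B\<bar>)"
  have B': "ennreal (2 powr l) * (1 + ennreal B) \<le> ennreal ?B"
    by (cases "0 \<le> B") (auto simp: ennreal_1[symmetric] ennreal_plus[symmetric] ennreal_mult[symmetric] ennreal_neg intro!: ennreal_leI simp del: ennreal_1 ennreal_plus)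
  have weighted: "(\<integral>\<^sup>+x. ennreal (u x) * ennreal ((1 + norm x) powr l) \<partial>lebesgue) \<le> ennreal ?B"
    if [measurable]: "u \<in> borel_measurable lebesgue" and "(\<integral>\<^sup>+x. ennreal (u x) \<partial>lebesgue) \<le> 1"
      "pot lebesgue (ker l) (\<lambda>x. ennreal (u x)) 0 \<le> ennreal B" for u :: "'a \<Rightarrow> real"
    using that(2,3)
    by (intro order_trans[OF weighted_mass_le[OF _ l]] order_trans[OF mult_left_mono[OF add_mono] B']) auto
  have h1: "1 \<le> (\<integral>\<^sup>+x. ennreal (h x powr q) \<partial>lebesgue)"
  proof (rule weak_limit_powr_lower[where r=r and \<kappa>=\<kappa> and l=l and B="?B"])
    show "weak_limit G lebesgue (\<lambda>j x. ennreal (min (r j x) (real (\<kappa> j) * indicator (cball 0 (real (\<kappa> j))) x))) (\<lambda>x. ennreal (h x))"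
      using wl by (simp add: f_def \<psi>_def)
    show "(\<integral>\<^sup>+x. ennreal ((1 + norm x) powr l * r j x) \<partial>lebesgue) \<le> ennreal ?B" for j
      using weighted[OF r mass1 pot0, of j] r0 by (simp add: ennreal_mult mult.commute)
  qed (use r r0 hm h0 l q mass1 powr1 kappa in auto)
  \<comment> \<open>The moment bound with \<open>K = 1\<close>, together with lower semicontinuity
    of the weighted moment.\<close>
  have hfin: "(\<integral>\<^sup>+x. ennreal (h x powr q) \<partial>lebesgue) < top"
  proof -
    define p where "p = l * q / (1 - q)"
    have p: "real DIM('a) < p"
    proof -
      have "real DIM('a) < q * (real DIM('a) + l)" using q(1) l by (simp add: pos_divide_less_eq)
      then show ?thesis using q by (simp add: p_def pos_less_divide_eq algebra_simps)
    qed
    have "(\<integral>\<^sup>+x. ennreal (h x powr q) \<partial>lebesgue)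
        \<le> (\<integral>\<^sup>+x. ennreal (h x) * ennreal ((1 + norm x) powr l) + ennreal ((1 + norm x) powr (-p)) \<partial>lebesgue)"
    proof (intro nn_integral_mono)
      fix x :: 'a
      show "ennreal (h x powr q) \<le> ennreal (h x) * ennreal ((1 + norm x) powr l) + ennreal ((1 + norm x) powr (-p))"
        using powr_moment_bound[of "h x" 1 q x l] h0[of x] q0 q
        by (simp add: p_def mult.commute ennreal_mult[symmetric] ennreal_plus[symmetric] ennreal_leI del: ennreal_plus)
    qed
    also have "\<dots> = (\<integral>\<^sup>+x. ennreal (h x) * ennreal ((1 + norm x) powr l) \<partial>lebesgue) + (\<integral>\<^sup>+x. ennreal ((1 + norm (x::'a)) powr (-p)) \<partial>lebesgue)"
      by (rule nn_integral_add) measurable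
    also have "\<dots> < top"
    proof -
      have "(\<integral>\<^sup>+x. ennreal (h x) * ennreal ((1 + norm x) powr l) \<partial>lebesgue)
          \<le> L (\<lambda>j. \<integral>\<^sup>+x. ennreal (f j x) * ennreal ((1 + norm x) powr l) \<partial>lebesgue)"
        by (rule weak_lower) measurable
      also have "\<dots> \<le> L (\<lambda>_. ennreal ?B)" by (rule L_mono) (rule weighted[OF fm mf V0])
      also have "\<dots> < top" by simp
      finally show ?thesis using nn_integral_weight_finite[OF p] by simp
    qed
    finally show ?thesis .
  qed
  \<comment> \<open>Removed density and Dirac mass both cost at least twice their mass times this
    infimum, the price of placing them at one optimal point. \<open>Y j\<close> attains it up to
    \<open>1/(j+1)\<close>.\<close>
  define v where "v j = (INF y. ?V j y)" for j
  have vB: "v j \<le> ennreal B" for j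
    using V0[of j] unfolding v_def by (rule INF_lower2[of 0, rotated]) simp
  have "\<exists>y. ?V j y \<le> v j + ennreal (1 / real (Suc j))" for j
  proof -
    have "v j < v j + ennreal (1 / real (Suc j))"
      using vB[of j] ennreal_add_left_cancel_less[of "v j" 0 "ennreal (1 / real (Suc j))"] by (auto simp: top_unique)
    then have "\<exists>y\<in>UNIV. ?V j y < v j + ennreal (1 / real (Suc j))"
      unfolding v_def[of j] INF_less_iff .
    then show ?thesis by (auto intro: less_imp_le)
  qed
  then obtain Y where Y: "\<And>j. ?V j (Y j) \<le> v j + ennreal (1 / real (Suc j))" by metis
  have Lh: "L (\<lambda>j. \<integral>\<^sup>+x. ennreal (f j x) \<partial>lebesgue) = (\<integral>\<^sup>+x. ennreal (h x) \<partial>lebesgue)"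
    by (rule weak_total)
  \<comment> \<open>The truncated densities keep more than the mass \<open>\<mu>\<close> eventually,
    so \<open>mass_powr_le_pot\<close> confines \<open>Y j\<close> to a ball. The mass of
    \<open>h\<close> is positive because its \<open>q\<close>-integral is at least 1.\<close>
  obtain \<mu> where mu: "0 < \<mu>" "ennreal \<mu> < (\<integral>\<^sup>+x. ennreal (h x) \<partial>lebesgue)"
  proof -
    have "(\<integral>\<^sup>+x. ennreal (h x) \<partial>lebesgue) \<noteq> 0"
    proof
      assume "(\<integral>\<^sup>+x. ennreal (h x) \<partial>lebesgue) = 0"
      then have "AE x in lebesgue. ennreal (h x) = 0" by (subst (asm) nn_integral_0_iff_AE) auto
      then have "AE x in lebesgue. ennreal (h x powr q) = 0"
        by eventually_elim (use h0 in \<open>auto simp: ennreal_eq_0_iff intro: antisym\<close>)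
      then have "(\<integral>\<^sup>+x. ennreal (h x powr q) \<partial>lebesgue) = 0" by (subst nn_integral_0_iff_AE) auto
      then show False using h1 by simp
    qed
    then have "0 < (\<integral>\<^sup>+x. ennreal (h x) \<partial>lebesgue)" by (simp add: zero_less_iff_neq_zero)
    then obtain b where b: "0 < b" "b < (\<integral>\<^sup>+x. ennreal (h x) \<partial>lebesgue)" using dense by blast
    have bt: "b < top" by (rule less_le_trans[OF b(2)]) simp
    then have "b = ennreal (enn2real b)" by simp
    with b bt show ?thesis by (intro that[of "enn2real b"]) (auto simp: enn2real_positive_iff)
  qed
  define A where "A = 2 powr l * (1 + 2 * \<bar>B\<bar>) / \<mu>"
  have "eventually (\<lambda>j. Y j \<in> cball 0 (A powr (1 / l))) G"
  proof -
    have "eventually (\<lambda>j. ennreal \<mu> < (\<integral>\<^sup>+x. ennreal (f j x) \<partial>lebesgue)) G"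
      by (rule order_tendstoD(1)[OF tendsto_L]) (simp add: Lh mu)
    then show ?thesis
    proof eventually_elim
      case (elim j)
      have "ennreal (norm (Y j) powr l * \<mu>) \<le> ennreal (norm (Y j) powr l) * (\<integral>\<^sup>+x. ennreal (f j x) \<partial>lebesgue)"
        using elim mu(1) by (simp add: ennreal_mult mult_left_mono)
      also have "\<dots> \<le> ennreal (2 powr l) * (?V j (Y j) + ?V j 0)"
        by (rule mass_powr_le_pot[OF _ l]) measurable
      also have "\<dots> \<le> ennreal (2 powr l) * ((ennreal \<bar>B\<bar> + 1) + ennreal \<bar>B\<bar>)"
      proof (intro mult_left_mono add_mono)
        have BB: "ennreal B \<le> ennreal \<bar>B\<bar>" by (rule ennreal_leI) simp
        show "?V j 0 \<le> ennreal \<bar>B\<bar>" by (rule order_trans[OF V0 BB])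
        have "ennreal (1 / real (Suc j)) \<le> ennreal 1" by (rule ennreal_leI) simp
        then show "?V j (Y j) \<le> ennreal \<bar>B\<bar> + 1"
          by (intro order_trans[OF Y] add_mono order_trans[OF vB BB]) simp
      qed simp
      also have "\<dots> = ennreal (2 powr l * (1 + 2 * \<bar>B\<bar>))"
        by (simp add: ennreal_1[symmetric] ennreal_plus[symmetric] ennreal_mult[symmetric] algebra_simps del: ennreal_1 ennreal_plus)
      finally have "norm (Y j) powr l * \<mu> \<le> 2 powr l * (1 + 2 * \<bar>B\<bar>)" by (subst (asm) ennreal_le_iff) auto
      then have "norm (Y j) powr l \<le> A" using mu(1) by (simp add: A_def pos_le_divide_eq)
      then have "(norm (Y j) powr l) powr (1 / l) \<le> A powr (1 / l)" using l by (intro powr_mono2) auto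
      then show ?case using l by (simp add: powr_powr)
    qed
  qed
  from ultra_convergent[OF ultra compact_cball this] obtain y where y: "(Y \<longlongrightarrow> y) G" by blast
  \<comment> \<open>The limit of all mass outside the truncated densities: the part cut off plus the
    original Dirac masses.\<close>
  define a where "a = L (\<lambda>j. (\<integral>\<^sup>+x. ennreal (g j x) \<partial>lebesgue) + ennreal (m j))"
  have ha: "(\<integral>\<^sup>+x. ennreal (h x) \<partial>lebesgue) + a = 1"
  proof -
    have "(\<integral>\<^sup>+x. ennreal (f j x) \<partial>lebesgue) + ((\<integral>\<^sup>+x. ennreal (g j x) \<partial>lebesgue) + ennreal (m j)) = 1" for j
      unfolding mass[of j, symmetric] fg by (subst nn_integral_add) (auto simp: add.assoc)
    then show ?thesis unfolding a_def Lh[symmetric] L_add[symmetric] by simp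
  qed
  then have a1: "a \<le> 1" by (metis add_increasing order_refl zero_le)
  then have afin: "a < top" by (auto simp: less_top[symmetric] top_unique)
  have vfin: "L v < top"
    by (rule le_less_trans[OF L_mono[of v "\<lambda>_. ennreal B", OF vB]]) simp
  have hv: "pot lebesgue (ker l) (\<lambda>x. ennreal (h x)) y \<le> L v"
  proof -
    have "pot lebesgue (ker l) (\<lambda>x. ennreal (h x)) y \<le> L (\<lambda>j. ?V j (Y j))" by (rule ker_pot_lower[OF y])
    also have "\<dots> \<le> L (\<lambda>j. v j + ennreal (1 / real (Suc j)))" by (rule L_mono[OF Y])
    also have "\<dots> = L v + L (\<lambda>j. ennreal (1 / real (Suc j)))" by (rule L_add)
    also have "L (\<lambda>j. ennreal (1 / real (Suc j))) = 0"
    proof (rule L_eq_LIMSEQ)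
      have "(\<lambda>j. 1 / real (Suc j)) \<longlonglongrightarrow> 0"
        using LIMSEQ_inverse_real_of_nat by (simp add: inverse_eq_divide)
      from tendsto_ennrealI[OF this] show "(\<lambda>j. ennreal (1 / real (Suc j))) \<longlonglongrightarrow> 0" by simp
    qed
    finally show ?thesis by simp
  qed
  \<comment> \<open>Lower semicontinuity passes to limits, \<open>L_mult\<close> merges those of the
    removed mass and of \<open>v\<close>, and \<open>bilin_add_lower\<close> returns to the energy
    of the full \<open>r j\<close>.\<close>
  have "bilin lebesgue (ker l) (\<lambda>x. ennreal (h x)) (\<lambda>x. ennreal (h x)) + 2 * a * pot lebesgue (ker l) (\<lambda>x. ennreal (h x)) y
      \<le> L (\<lambda>j. bilin lebesgue (ker l) (\<lambda>x. ennreal (f j x)) (\<lambda>x. ennreal (f j x))) + 2 * a * L v"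
    by (intro add_mono ker_bilin_lower mult_left_mono hv) simp
  also have "\<dots> = L (\<lambda>j. bilin lebesgue (ker l) (\<lambda>x. ennreal (f j x)) (\<lambda>x. ennreal (f j x))
      + 2 * (((\<integral>\<^sup>+x. ennreal (g j x) \<partial>lebesgue) + ennreal (m j)) * v j))"
  proof -
    have "2 * a * L v = 2 * (a * L v)" by (rule mult.assoc)
    also have "a * L v = L (\<lambda>j. ((\<integral>\<^sup>+x. ennreal (g j x) \<partial>lebesgue) + ennreal (m j)) * v j)"
      using afin vfin unfolding a_def by (rule L_mult[symmetric])
    finally show ?thesis by (simp only: L_add L_cmult ennreal_numeral_less_top)
  qed
  also have "\<dots> \<le> L c"
  proof (rule L_mono)
    fix j
    have "bilin lebesgue (ker l) (\<lambda>x. ennreal (f j x)) (\<lambda>x. ennreal (f j x))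
      + 2 * (((\<integral>\<^sup>+x. ennreal (g j x) \<partial>lebesgue) + ennreal (m j)) * v j)
      \<le> bilin lebesgue (ker l) (\<lambda>x. ennreal (f j x) + ennreal (g j x)) (\<lambda>x. ennreal (f j x) + ennreal (g j x))
      + 2 * ennreal (m j) * pot lebesgue (ker l) (\<lambda>x. ennreal (f j x) + ennreal (g j x)) (z j)"
      by (rule bilin_add_lower[OF sigma_finite_lebesgue measurable_ker ker_commute])
        (auto simp: v_def intro: INF_lower)
    also have "\<dots> \<le> c j" using en[of j] by (simp only: fg)
    finally show "bilin lebesgue (ker l) (\<lambda>x. ennreal (f j x)) (\<lambda>x. ennreal (f j x))
      + 2 * (((\<integral>\<^sup>+x. ennreal (g j x) \<partial>lebesgue) + ennreal (m j)) * v j) \<le> c j" .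
  qed
  also have "\<dots> = C" by (rule L_eq_LIMSEQ[OF c])
  finally have "bilin lebesgue (ker l) (\<lambda>x. ennreal (h x)) (\<lambda>x. ennreal (h x)) + 2 * a * pot lebesgue (ker l) (\<lambda>x. ennreal (h x)) y \<le> C" .
  moreover have "ennreal (enn2real a) = a" using afin by simp
  ultimately show ?thesis
    using hm h0 ha h1 hfin by - (rule exI[of _ h], rule exI[of _ "enn2real a"], rule exI[of _ y], simp)
qed

section \<open>Scaling\<close>

lemma measurable_lebesgue_affine:
  fixes t :: "'a::euclidean_space"
  assumes "b \<noteq> 0"
  shows "(\<lambda>x. t + b *\<^sub>R x) \<in> lebesgue \<rightarrow>\<^sub>M lebesgue"
proof -
  have "(\<lambda>x. t + (\<Sum>j\<in>Basis. (b * (x \<bullet> j)) *\<^sub>R j)) = (\<lambda>x::'a. t + b *\<^sub>R x)"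
    unfolding scaleR_scaleR[symmetric] scaleR_sum_right[symmetric] euclidean_representation ..
  then show ?thesis using lebesgue_affine_measurable[of "\<lambda>_. b" t] assms by simp
qed

lemma nn_integral_lebesgue_affine:
  fixes t :: "'a::euclidean_space"
  assumes g[measurable]: "g \<in> borel_measurable lebesgue" and b: "0 < b"
  shows "(\<integral>\<^sup>+x. g x \<partial>lebesgue) = ennreal (b powr real DIM('a)) * (\<integral>\<^sup>+x. g (t + b *\<^sub>R x) \<partial>lebesgue)"
proof -
  have [measurable]: "(\<lambda>x. t + b *\<^sub>R x) \<in> lebesgue \<rightarrow>\<^sub>M lebesgue"
    by (rule measurable_lebesgue_affine) (use b in simp)
  have "(\<lambda>x. t + (\<Sum>j\<in>Basis. (b * (x \<bullet> j)) *\<^sub>R j)) = (\<lambda>x::'a. t + b *\<^sub>R x)"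
    unfolding scaleR_scaleR[symmetric] scaleR_sum_right[symmetric] euclidean_representation ..
  then have "(lebesgue :: 'a measure) = density (distr lebesgue lebesgue (\<lambda>x. t + b *\<^sub>R x)) (\<lambda>_. ennreal (b powr real DIM('a)))"
    using lebesgue_affine_euclidean[of "\<lambda>_. b" t] b by (simp add: powr_realpow)
  then have "(\<integral>\<^sup>+x. g x \<partial>lebesgue) = (\<integral>\<^sup>+x. g x \<partial>density (distr lebesgue lebesgue (\<lambda>x. t + b *\<^sub>R x)) (\<lambda>_. ennreal (b powr real DIM('a))))"
    by simp
  also have "\<dots> = ennreal (b powr real DIM('a)) * (\<integral>\<^sup>+x. g (t + b *\<^sub>R x) \<partial>lebesgue)"
    by (subst nn_integral_density) (auto simp: nn_integral_distr nn_integral_cmult)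
  finally show ?thesis .
qed

lemma pot_affine:
  fixes t :: "'a::euclidean_space"
  assumes u[measurable]: "u \<in> borel_measurable lebesgue" and b: "0 < b"
  shows "pot lebesgue (ker l) u (t + b *\<^sub>R y)
    = ennreal (b powr (real DIM('a) + l)) * pot lebesgue (ker l) (\<lambda>x. u (t + b *\<^sub>R x)) y"
proof -
  have [measurable]: "(\<lambda>x. u (t + b *\<^sub>R x)) \<in> borel_measurable lebesgue"
    by (rule measurable_compose[OF measurable_lebesgue_affine u]) (use b in simp)
  have k: "ker l (t + b *\<^sub>R x) (t + b *\<^sub>R y) = ennreal (b powr l) * ker l x y" for x
    using b by (simp add: ker_def scaleR_diff_right[symmetric] powr_mult ennreal_mult)
  have "pot lebesgue (ker l) u (t + b *\<^sub>R y)
      = ennreal (b powr real DIM('a)) * (\<integral>\<^sup>+x. ennreal (b powr l) * (u (t + b *\<^sub>R x) * ker l x y) \<partial>lebesgue)"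
    unfolding pot_def by (subst nn_integral_lebesgue_affine[OF _ b, of _ t]) (measurable, simp add: k mult_ac)
  also have "\<dots> = ennreal (b powr real DIM('a)) * (ennreal (b powr l) * pot lebesgue (ker l) (\<lambda>x. u (t + b *\<^sub>R x)) y)"
    unfolding pot_def by (subst nn_integral_cmult) auto
  finally show ?thesis by (simp add: powr_add ennreal_mult mult_ac)
qed

lemma measurable_pot [measurable]:
  fixes u :: "'a::euclidean_space \<Rightarrow> ennreal"
  assumes [measurable]: "u \<in> borel_measurable lebesgue"
  shows "pot lebesgue (ker l) u \<in> borel_measurable lebesgue"
proof -
  interpret sigma_finite_measure "lebesgue :: 'a measure" by (rule sigma_finite_lebesgue)
  have [measurable]: "(\<lambda>(y, x). ker l x y) \<in> borel_measurable ((lebesgue :: 'a measure) \<Otimes>\<^sub>M lebesgue)"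
    unfolding ker_def by measurable
  show ?thesis unfolding pot_def[abs_def] by measurable
qed

lemma bilin_eq_pot:
  fixes u :: "'a::euclidean_space \<Rightarrow> ennreal"
  assumes [measurable]: "u \<in> borel_measurable lebesgue"
  shows "bilin lebesgue (ker l) u v = (\<integral>\<^sup>+y. pot lebesgue (ker l) u y * v y \<partial>lebesgue)"
  unfolding bilin_def pot_def by (intro nn_integral_cong nn_integral_multc) measurable

lemma bilin_affine:
  fixes t :: "'a::euclidean_space"
  assumes u[measurable]: "u \<in> borel_measurable lebesgue" and b: "0 < b"
  shows "bilin lebesgue (ker l) u u
    = ennreal (b powr (2 * real DIM('a) + l)) * bilin lebesgue (ker l) (\<lambda>x. u (t + b *\<^sub>R x)) (\<lambda>x. u (t + b *\<^sub>R x))"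
proof -
  have [measurable]: "(\<lambda>x. u (t + b *\<^sub>R x)) \<in> borel_measurable lebesgue"
    by (rule measurable_compose[OF measurable_lebesgue_affine u]) (use b in simp)
  have "bilin lebesgue (ker l) u u = ennreal (b powr real DIM('a)) *
      (\<integral>\<^sup>+y. pot lebesgue (ker l) u (t + b *\<^sub>R y) * u (t + b *\<^sub>R y) \<partial>lebesgue)"
    unfolding bilin_eq_pot[OF u] by (rule nn_integral_lebesgue_affine[OF _ b]) measurable
  also have "\<dots> = ennreal (b powr real DIM('a)) * (ennreal (b powr (real DIM('a) + l)) *
      bilin lebesgue (ker l) (\<lambda>x. u (t + b *\<^sub>R x)) (\<lambda>x. u (t + b *\<^sub>R x)))"
    by (simp add: pot_affine[OF u b] bilin_eq_pot mult.assoc nn_integral_cmult)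
  also have "\<dots> = ennreal (b powr (2 * real DIM('a) + l)) * bilin lebesgue (ker l) (\<lambda>x. u (t + b *\<^sub>R x)) (\<lambda>x. u (t + b *\<^sub>R x))"
    by (simp add: mult.assoc[symmetric] ennreal_mult[symmetric] powr_add[symmetric] algebra_simps)
  finally show ?thesis .
qed

lemma pot_cmult:
  fixes u :: "'a::euclidean_space \<Rightarrow> ennreal"
  assumes [measurable]: "u \<in> borel_measurable lebesgue"
  shows "pot lebesgue (ker l) (\<lambda>x. a * u x) y = a * pot lebesgue (ker l) u y"
  unfolding pot_def by (subst nn_integral_cmult[symmetric]) (auto simp: mult_ac)

lemma bilin_cmult:
  fixes u :: "'a::euclidean_space \<Rightarrow> ennreal"
  assumes [measurable]: "u \<in> borel_measurable lebesgue"
  shows "bilin lebesgue (ker l) (\<lambda>x. a * u x) (\<lambda>x. a * u x) = a * a * bilin lebesgue (ker l) u u"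
proof -
  have "bilin lebesgue (ker l) (\<lambda>x. a * u x) (\<lambda>x. a * u x) = (\<integral>\<^sup>+y. (a * a) * (pot lebesgue (ker l) u y * u y) \<partial>lebesgue)"
    by (simp add: bilin_eq_pot pot_cmult mult_ac)
  then show ?thesis by (simp add: bilin_eq_pot nn_integral_cmult)
qed

lemma energy_eq_bilin:
  assumes "\<And>x. 0 \<le> r x"
  shows "energy l r = bilin lebesgue (ker l) (\<lambda>x. ennreal (r x)) (\<lambda>x. ennreal (r x))"
  unfolding energy_def bilin_def ker_def using assms by (simp add: ennreal_mult)

lemma moment_eq_pot:
  assumes "\<And>x. 0 \<le> r x"
  shows "moment l r = pot lebesgue (ker l) (\<lambda>x. ennreal (r x)) 0"
  unfolding moment_def pot_def ker_def using assms by (simp add: ennreal_mult mult.commute)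

section \<open>Normalization of admissible pairs by dilation and translation\<close>

lemma densitiesD:
  assumes "r \<in> densities q"
  shows "r \<in> borel_measurable lebesgue" "0 \<le> r x"
    "(\<integral>\<^sup>+x. ennreal (r x) \<partial>lebesgue) = ennreal (\<integral>x. r x \<partial>lebesgue)" "0 < (\<integral>x. r x \<partial>lebesgue)"
    "(\<integral>\<^sup>+x. ennreal (r x powr q) \<partial>lebesgue) = ennreal (\<integral>x. r x powr q \<partial>lebesgue)" "0 < (\<integral>x. r x powr q \<partial>lebesgue)"
proof -
  show r[measurable]: "r \<in> borel_measurable lebesgue" using assms by (simp add: densities_def Lp_def)
  have r0: "\<And>x. 0 \<le> r x" using assms by (simp add: densities_def)
  then show "0 \<le> r x" .
  have nz: "\<not> (AE x in lebesgue. r x = 0)" using assms by (simp add: densities_def)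
  have *: "(\<integral>\<^sup>+x. ennreal (u x) \<partial>lebesgue) = ennreal (\<integral>x. u x \<partial>lebesgue) \<and> 0 < (\<integral>x. u x \<partial>lebesgue)"
    if [measurable]: "u \<in> borel_measurable lebesgue" and u0: "\<And>x. 0 \<le> u x" and fin: "(\<integral>\<^sup>+x. ennreal (u x) \<partial>lebesgue) < \<infinity>"
      and iff: "\<And>x. u x = 0 \<longleftrightarrow> r x = 0" for u
  proof -
    have int: "integrable lebesgue u" using fin u0 by (intro integrableI_nonneg) auto
    then have eq: "(\<integral>\<^sup>+x. ennreal (u x) \<partial>lebesgue) = ennreal (\<integral>x. u x \<partial>lebesgue)"
      using u0 by (intro nn_integral_eq_integral) auto
    have "(\<integral>x. u x \<partial>lebesgue) \<noteq> 0"
      using nz u0 by (subst integral_nonneg_eq_0_iff_AE[OF int]) (auto simp: iff)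
    moreover have "0 \<le> (\<integral>x. u x \<partial>lebesgue)" using u0 by simp
    ultimately show ?thesis using eq by simp
  qed
  have "(\<integral>\<^sup>+x. ennreal (r x) \<partial>lebesgue) < \<infinity>" "(\<integral>\<^sup>+x. ennreal (r x powr q) \<partial>lebesgue) < \<infinity>"
    using assms r0 by (auto simp: densities_def Lp_def)
  with *[of r] *[of "\<lambda>x. r x powr q"] r0
  show "(\<integral>\<^sup>+x. ennreal (r x) \<partial>lebesgue) = ennreal (\<integral>x. r x \<partial>lebesgue)" "0 < (\<integral>x. r x \<partial>lebesgue)"
    "(\<integral>\<^sup>+x. ennreal (r x powr q) \<partial>lebesgue) = ennreal (\<integral>x. r x powr q \<partial>lebesgue)" "0 < (\<integral>x. r x powr q \<partial>lebesgue)"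
    by auto
qed

text \<open>The scaled density is \<open>a * r (b *\<^sub>R x)\<close>. The two normalizations read
  \<open>a * m = b powr N\<close> and \<open>a powr q * s = b powr N\<close>; dividing them
  determines \<open>a\<close>, and then \<open>b\<close>. The last identity is the scale invariance
  that fixes the exponent \<open>alpha\<close>.\<close>

lemma scaling_constants:
  fixes m s q l :: real and N :: nat
  assumes "0 < m" "0 < s" "0 < q" "q < 1" "0 < N"
  defines "a \<equiv> (s / m) powr (1 / (1 - q))"
  defines "b \<equiv> (a * m) powr (1 / real N)"
  shows "0 < a" "0 < b" "a * m = b powr real N" "a powr q * s = b powr real N"
    "a * a * (m powr alpha N l q * s powr ((2 - alpha N l q) / q)) = b powr (2 * real N + l)"
proof -
  show a: "0 < a" using assms by (simp add: a_def)
  show b: "0 < b" using a assms by (simp add: b_def)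
  show am: "a * m = b powr real N" using a assms by (simp add: b_def powr_powr)
  \<comment> \<open>In logarithms the remaining identities are linear in \<open>ln a\<close> and
    \<open>ln m\<close>.\<close>
  have lna: "ln a = (ln s - ln m) / (1 - q)" using assms(1-5) by (simp add: a_def ln_powr ln_div)
  have lnb: "ln b = (ln a + ln m) / real N" using a assms(1-5) by (simp add: b_def ln_powr ln_mult)
  have "a powr q * s = exp (q * ln a + ln s)" using a assms(2) by (simp add: powr_def exp_add)
  also have "q * ln a + ln s = ln a + ln m" unfolding lna using assms(4) by (simp add: field_simps)
  also have "exp (ln a + ln m) = a * m" using a assms(1) by (simp add: exp_add)
  finally show "a powr q * s = b powr real N" using am by simp
  define \<alpha> where "\<alpha> = alpha N l q"
  have al: "\<alpha> * (real N * (1 - q)) = 2 * real N - q * (2 * real N + l)"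
    using assms(4,5) by (simp add: \<alpha>_def alpha_def)
  have e2: "(2 - \<alpha>) / q = l / (real N * (1 - q))"
  proof -
    have "(2 - \<alpha>) * (real N * (1 - q)) = l * q" using al by (simp add: algebra_simps)
    then show ?thesis using assms(3-5) by (simp add: field_simps)
  qed
  have e1: "\<alpha> = 2 - l * q / (real N * (1 - q))"
    using e2 assms(3-5) by (simp add: field_simps)
  have "a * a * (m powr \<alpha> * s powr ((2 - \<alpha>) / q)) = exp (ln a + ln a + (\<alpha> * ln m + (2 - \<alpha>) / q * ln s))"
    using a assms(1,2) by (simp add: powr_def exp_add exp_double power2_eq_square)
  also have "ln a + ln a + (\<alpha> * ln m + (2 - \<alpha>) / q * ln s) = (2 * real N + l) * ln b"
  proof -
    define n where "n = real N"
    have n: "0 < n" using assms(5) by (simp add: n_def)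
    have q1: "1 - q \<noteq> 0" using assms(4) by simp
    have "ln s = (1 - q) * ln a + ln m" unfolding lna using q1 by simp
    moreover have "l / (n * w) * (w * x + y) = l / n * x + l / (n * w) * y" if "w \<noteq> 0" for w x y
      using that n by (simp add: field_simps)
    ultimately have "(2 - \<alpha>) / q * ln s = l / n * ln a + l / (n * (1 - q)) * ln m"
      unfolding e2 n_def[symmetric] using q1 by metis
    moreover have "l * q / (n * (1 - q)) = l / (n * (1 - q)) - l / n" using n q1 by (simp add: field_simps)
    then have "\<alpha> * ln m = (2 - l / (n * (1 - q)) + l / n) * ln m" unfolding e1 n_def[symmetric] by simp
    moreover have "(2 * n + l) * ln b = (2 + l / n) * (ln a + ln m)"
      unfolding lnb n_def[symmetric] using n by (simp add: field_simps)
    ultimately show ?thesis unfolding n_def[symmetric] by (simp add: algebra_simps)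
  qed
  also have "exp ((2 * real N + l) * ln b) = b powr (2 * real N + l)" using b by (simp add: powr_def)
  finally show "a * a * (m powr alpha N l q * s powr ((2 - alpha N l q) / q)) = b powr (2 * real N + l)"
    by (simp add: \<alpha>_def)
qed

text \<open>The scaling of \<open>scaling_constants\<close> with total mass \<open>S + M\<close>
  turns the Dirac mass \<open>M\<close> into \<open>a * M / b powr N\<close>. The quotient is
  invariant and both factors of its denominator become 1, so the new numerator is the old
  quotient.\<close>

lemma normalize_scale:
  fixes r :: "real ^ 'n::finite \<Rightarrow> real"
  assumes r: "r \<in> densities q" and M: "0 \<le> M" and q: "0 < q" "q < 1"
  shows "\<exists>(r' :: real ^ 'n \<Rightarrow> real) m. r' \<in> borel_measurable lebesgue \<and> (\<forall>x. 0 \<le> r' x) \<and> 0 \<le> m \<and>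
    (\<integral>\<^sup>+x. ennreal (r' x) \<partial>lebesgue) + ennreal m = 1 \<and> (\<integral>\<^sup>+x. ennreal (r' x powr q) \<partial>lebesgue) = 1 \<and>
    bilin lebesgue (ker l) (\<lambda>x. ennreal (r' x)) (\<lambda>x. ennreal (r' x))
      + 2 * ennreal m * pot lebesgue (ker l) (\<lambda>x. ennreal (r' x)) 0 = Q_rel l q r M"
proof -
  note [measurable] = densitiesD(1)[OF r]
  note r0 = densitiesD(2)[OF r]
  define S where "S = (\<integral>x. r x \<partial>lebesgue)"
  define s where "s = (\<integral>x. r x powr q \<partial>lebesgue)"
  define N where "N = CARD('n)"
  define a where "a = (s / (S + M)) powr (1 / (1 - q))"
  define b where "b = (a * (S + M)) powr (1 / real N)"
  have S: "0 < S" "(\<integral>\<^sup>+x. ennreal (r x) \<partial>lebesgue) = ennreal S"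
    and s: "0 < s" "(\<integral>\<^sup>+x. ennreal (r x powr q) \<partial>lebesgue) = ennreal s"
    using densitiesD[OF r] by (simp_all add: S_def s_def)
  have N: "0 < N" "real DIM(real ^ 'n) = real N" by (simp_all add: N_def)
  have SM: "0 < S + M" using S M by simp
  note sc = scaling_constants[OF SM s(1) q N(1), folded a_def, folded b_def]
  define d where "d = (S + M) powr alpha N l q * s powr ((2 - alpha N l q) / q)"
  have d: "0 < d" using SM s by (simp add: d_def)
  define bN where "bN = b powr real N"
  have bN: "0 < bN" using sc(2) by (simp add: bN_def)
  let ?u = "\<lambda>x. ennreal (r x)"
  let ?u' = "\<lambda>x. ennreal (r (0 + b *\<^sub>R x))"
  have [measurable]: "(\<lambda>x. 0 + b *\<^sub>R x) \<in> (lebesgue :: (real ^ 'n) measure) \<rightarrow>\<^sub>M lebesgue"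
    using sc(2) by (intro measurable_lebesgue_affine) simp
  have inv: "A = ennreal c * B \<Longrightarrow> 0 < c \<Longrightarrow> B = ennreal (1 / c) * A" for A B and c :: real
    by (simp add: mult.assoc[symmetric] ennreal_mult[symmetric])
  have i1: "(\<integral>\<^sup>+x. ?u' x \<partial>lebesgue) = ennreal (1 / bN) * ennreal S"
    unfolding S(2)[symmetric]
    by (rule inv[OF _ bN]) (use nn_integral_lebesgue_affine[of ?u b 0] sc(2) N in \<open>simp add: bN_def\<close>)
  have i2: "(\<integral>\<^sup>+x. ennreal (r (0 + b *\<^sub>R x) powr q) \<partial>lebesgue) = ennreal (1 / bN) * ennreal s"
    unfolding s(2)[symmetric]
    by (rule inv[OF _ bN]) (use nn_integral_lebesgue_affine[of "\<lambda>x. ennreal (r x powr q)" b 0] sc(2) N in \<open>simp add: bN_def\<close>)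
  have i3: "pot lebesgue (ker l) ?u' 0 = ennreal (1 / b powr (real N + l)) * pot lebesgue (ker l) ?u 0"
    by (rule inv) (use pot_affine[of ?u b l 0 0] sc(2) N in simp_all)
  have i4: "bilin lebesgue (ker l) ?u' ?u' = ennreal (1 / b powr (2 * real N + l)) * bilin lebesgue (ker l) ?u ?u"
    by (rule inv) (use bilin_affine[of ?u b l 0] sc(2) N in simp_all)
  define r' where "r' x = a * r (0 + b *\<^sub>R x)" for x
  define m where "m = a * M / bN"
  have r'e: "(\<lambda>x. ennreal (r' x)) = (\<lambda>x. ennreal a * ?u' x)"
    using sc(1) r0 by (simp add: r'_def ennreal_mult)
  have mass: "(\<integral>\<^sup>+x. ennreal (r' x) \<partial>lebesgue) + ennreal m = 1"
  proof -
    have "(\<integral>\<^sup>+x. ennreal (r' x) \<partial>lebesgue) = ennreal a * (ennreal (1 / bN) * ennreal S)"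
      unfolding r'e i1[symmetric] by (rule nn_integral_cmult) measurable
    also have "\<dots> + ennreal m = ennreal (a * (S + M) / bN)"
      using sc(1) bN S(1) M
      by (simp add: m_def ennreal_mult[symmetric] ennreal_plus[symmetric] distrib_left add_divide_distrib del: ennreal_plus)
    also have "\<dots> = 1" using sc(3) bN by (simp add: bN_def)
    finally show ?thesis .
  qed
  have powr1: "(\<integral>\<^sup>+x. ennreal (r' x powr q) \<partial>lebesgue) = 1"
  proof -
    have "(\<integral>\<^sup>+x. ennreal (r' x powr q) \<partial>lebesgue) = (\<integral>\<^sup>+x. ennreal (a powr q) * ennreal (r (0 + b *\<^sub>R x) powr q) \<partial>lebesgue)"
      using sc(1) r0 by (simp add: r'_def powr_mult ennreal_mult)
    also have "\<dots> = ennreal (a powr q) * (ennreal (1 / bN) * ennreal s)"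
      unfolding i2[symmetric] by (rule nn_integral_cmult) measurable
    also have "\<dots> = ennreal (a powr q * s / bN)"
      using bN s(1) by (simp add: ennreal_mult[symmetric])
    also have "\<dots> = 1" using sc(4) bN by (simp add: bN_def)
    finally show ?thesis .
  qed
  have "bilin lebesgue (ker l) (\<lambda>x. ennreal (r' x)) (\<lambda>x. ennreal (r' x))
      + 2 * ennreal m * pot lebesgue (ker l) (\<lambda>x. ennreal (r' x)) 0
      = ennreal (a * a) * (ennreal (1 / b powr (2 * real N + l)) * bilin lebesgue (ker l) ?u ?u)
      + 2 * ennreal m * (ennreal a * (ennreal (1 / b powr (real N + l)) * pot lebesgue (ker l) ?u 0))"
    unfolding r'e using sc(1) by (simp add: bilin_cmult pot_cmult ennreal_mult i3[simplified] i4[simplified])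
  also have "\<dots> = ennreal (1 / d) * (bilin lebesgue (ker l) ?u ?u + 2 * ennreal M * pot lebesgue (ker l) ?u 0)"
  proof -
    have dd: "a * a / b powr (2 * real N + l) = 1 / d"
    proof -
      have "a * a * d = b powr (2 * real N + l)" unfolding d_def by (rule sc(5))
      moreover have "b powr (2 * real N + l) \<noteq> 0" using sc(2) by simp
      ultimately show ?thesis using d by (simp add: nonzero_divide_eq_eq nonzero_eq_divide_eq)
    qed
    have "b powr (2 * real N + l) = bN * b powr (real N + l)"
      by (simp add: bN_def powr_add[symmetric] algebra_simps)
    then have "m * (a / b powr (real N + l)) = M * (a * a / b powr (2 * real N + l))"
      by (simp add: m_def)
    then have dm: "m * (a / b powr (real N + l)) = M / d"
      unfolding dd by simp
    have "ennreal (a * a) * (ennreal (1 / b powr (2 * real N + l)) * bilin lebesgue (ker l) ?u ?u)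
        = ennreal (a * a / b powr (2 * real N + l)) * bilin lebesgue (ker l) ?u ?u"
      using sc(1) by (simp add: mult.assoc[symmetric] ennreal_mult[symmetric])
    moreover have "2 * ennreal m * (ennreal a * (ennreal (1 / b powr (real N + l)) * pot lebesgue (ker l) ?u 0))
        = 2 * (ennreal (m * (a / b powr (real N + l))) * pot lebesgue (ker l) ?u 0)"
      using sc(1) M bN by (simp add: mult.assoc[symmetric] ennreal_mult[symmetric] m_def)
        (simp add: mult.assoc ennreal_mult[symmetric])
    moreover have "ennreal (M / d) = ennreal (1 / d) * ennreal M"
      using d M by (simp add: ennreal_mult[symmetric])
    ultimately show ?thesis unfolding dd dm by (simp add: distrib_left mult_ac)
  qed
  also have "\<dots> = Q_rel l q r M"
    unfolding Q_rel_def energy_eq_bilin[OF r0] moment_eq_pot[OF r0] S_def[symmetric] s_def[symmetric] N_def[symmetric] d_def[symmetric]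
    using d by (simp add: divide_ennreal_def inverse_ennreal mult.commute inverse_eq_divide)
  finally have "bilin lebesgue (ker l) (\<lambda>x. ennreal (r' x)) (\<lambda>x. ennreal (r' x))
      + 2 * ennreal m * pot lebesgue (ker l) (\<lambda>x. ennreal (r' x)) 0 = Q_rel l q r M" .
  moreover have "r' \<in> borel_measurable lebesgue" unfolding r'_def[abs_def] by measurable
  ultimately show ?thesis
    using mass powr1 r0 sc(1) M bN
    by - (rule exI[of _ r'], rule exI[of _ m], simp add: r'_def m_def)
qed

text \<open>The density plus the Dirac mass at the origin is a probability measure, so the infimum
  of the potential is at most its average, which is at most the numerator. Hence some point
  \<open>t\<close> has potential below \<open>C\<close>, and it is moved to the origin.\<close>

lemma normalize_translate:
  fixes r :: "'a::euclidean_space \<Rightarrow> real"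
  assumes r[measurable]: "r \<in> borel_measurable lebesgue" and r0: "\<And>x. 0 \<le> r x" and m: "0 \<le> m"
    and mass: "(\<integral>\<^sup>+x. ennreal (r x) \<partial>lebesgue) + ennreal m = 1"
    and en: "bilin lebesgue (ker l) (\<lambda>x. ennreal (r x)) (\<lambda>x. ennreal (r x))
      + 2 * ennreal m * pot lebesgue (ker l) (\<lambda>x. ennreal (r x)) 0 < C" 
  shows "\<exists>t. pot lebesgue (ker l) (\<lambda>x. ennreal (r (t + x))) 0 \<le> C"
proof -
  let ?V = "pot lebesgue (ker l) (\<lambda>x. ennreal (r x))"
  define v where "v = (INF y. ?V y)"
  have v: "v \<le> ?V y" for y unfolding v_def by (rule INF_lower) simp
  have "v = ((\<integral>\<^sup>+x. ennreal (r x) \<partial>lebesgue) + ennreal m) * v" by (simp add: mass)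
  also have "\<dots> = (\<integral>\<^sup>+x. v * ennreal (r x) \<partial>lebesgue) + ennreal m * v"
    by (simp add: nn_integral_cmult algebra_simps)
  also have "\<dots> \<le> bilin lebesgue (ker l) (\<lambda>x. ennreal (r x)) (\<lambda>x. ennreal (r x)) + 2 * ennreal m * ?V 0"
  proof (rule add_mono)
    show "(\<integral>\<^sup>+x. v * ennreal (r x) \<partial>lebesgue) \<le> bilin lebesgue (ker l) (\<lambda>x. ennreal (r x)) (\<lambda>x. ennreal (r x))"
      by (subst bilin_eq_pot) (auto intro!: nn_integral_mono mult_right_mono v)
    have "ennreal m * v \<le> ennreal m * ?V 0" by (intro mult_left_mono v) simp
    also have "\<dots> \<le> 2 * ennreal m * ?V 0"
      by (simp add: mult_2 distrib_right)
    finally show "ennreal m * v \<le> 2 * ennreal m * ?V 0" .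
  qed
  finally have "v < C" using en by (rule le_less_trans)
  then obtain t where "?V t < C" unfolding v_def INF_less_iff by blast
  moreover have "?V t = pot lebesgue (ker l) (\<lambda>x. ennreal (r (t + x))) 0"
    using pot_affine[of "\<lambda>x. ennreal (r x)" 1 l t 0] by simp
  ultimately show ?thesis by (intro exI[of _ t]) simp
qed

text \<open>Supplies a competitor for the case of an infinite infimum.\<close>

lemma densities_nonempty:
  "\<exists>r :: real ^ 'n::finite \<Rightarrow> real. r \<in> densities q"
proof
  let ?r = "indicator (cball 0 1) :: real ^ 'n \<Rightarrow> real"
  have B: "cball (0 :: real ^ 'n) 1 \<in> sets lebesgue" by simp
  have meas: "?r \<in> borel_measurable lebesgue" by (rule borel_measurable_indicator[OF B])
  have fin: "(\<integral>\<^sup>+x. ennreal (\<bar>?r x\<bar> powr p) \<partial>lebesgue) < \<infinity>" for p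
  proof -
    have "(\<integral>\<^sup>+x. ennreal (\<bar>?r x\<bar> powr p) \<partial>lebesgue) = (\<integral>\<^sup>+x. indicator (cball 0 1) x \<partial>(lebesgue :: (real ^ 'n) measure))"
      by (intro nn_integral_cong) (auto split: split_indicator)
    also have "\<dots> = emeasure lebesgue (cball (0 :: real ^ 'n) 1)" by (rule nn_integral_indicator[OF B])
    also have "\<dots> < \<infinity>" using emeasure_bounded_finite[of "cball (0 :: real ^ 'n) 1"] by simp
    finally show ?thesis .
  qed
  have "\<not> (AE x in lebesgue. ?r x = 0)"
  proof
    assume "AE x in lebesgue. ?r x = 0"
    then have "AE x in lebesgue. x \<notin> cball (0 :: real ^ 'n) 1" by eventually_elim (auto split: split_indicator_asm)
    then have "cball (0 :: real ^ 'n) 1 \<in> null_sets lebesgue" using B by (simp add: AE_iff_null_sets)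
    then have "emeasure lebesgue (cball (0 :: real ^ 'n) 1) = 0" by (rule null_setsD1)
    then show False
      using unit_ball_vol_pos[of "real CARD('n)", OF of_nat_0_le_iff] by (simp add: emeasure_cball ennreal_eq_0_iff)
  qed
  then show "?r \<in> densities q"
    using meas fin[of 1] fin[of q] by (simp add: densities_def Lp_def)
qed

section \<open>Existence of a minimizer for the relaxed quotient\<close>

theorem proposition10:
  fixes l q :: real
  assumes "l > 0"
    and "real CARD('n::finite) / (real CARD('n) + l) < q"
    and "q < 2 * real CARD('n) / (2 * real CARD('n) + l)"
  shows "\<exists>(\<rho> :: real ^ 'n \<Rightarrow> real) M. \<rho> \<in> densities q \<and> M \<ge> 0 \<and>
           Q_rel l q \<rho> M = C_rel TYPE('n) l q"
proof (cases "C_rel TYPE('n) l q = top")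
  \<comment> \<open>If the infimum is infinite, every admissible pair attains it.\<close>
  case True
  obtain r :: "real ^ 'n \<Rightarrow> real" where r: "r \<in> densities q" using densities_nonempty by blast
  then have "C_rel TYPE('n) l q \<le> Q_rel l q r 0" unfolding C_rel_def by (intro Inf_lower) auto
  then show ?thesis using True r by (intro exI[of _ r] exI[of _ 0]) (simp add: top_unique)
next
  case False
  define C where "C = C_rel TYPE('n) l q"
  have q0: "0 < q" by (rule le_less_trans[OF _ assms(2)]) (use assms(1) in simp)
  have "2 * real CARD('n) / (2 * real CARD('n) + l) \<le> 1" using assms(1) by simp
  with assms(3) have q1: "q < 1" by linarith
  have Cfin: "C < top" using False by (simp add: C_def less_top)
  let ?c = "\<lambda>j::nat. C + ennreal (1 / real (Suc j))"
  let ?pot = "\<lambda>r :: real ^ 'n \<Rightarrow> real. pot lebesgue (ker l) (\<lambda>x. ennreal (r x))"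
  let ?bil = "\<lambda>r :: real ^ 'n \<Rightarrow> real. bilin lebesgue (ker l) (\<lambda>x. ennreal (r x)) (\<lambda>x. ennreal (r x))"
  let ?P = "\<lambda>j (r :: real ^ 'n \<Rightarrow> real) m z. r \<in> borel_measurable lebesgue \<and> (\<forall>x. 0 \<le> r x) \<and> 0 \<le> m \<and>
      (\<integral>\<^sup>+x. ennreal (r x) \<partial>lebesgue) + ennreal m = 1 \<and> (\<integral>\<^sup>+x. ennreal (r x powr q) \<partial>lebesgue) = 1 \<and>
      ?pot r 0 \<le> ?c j \<and> ?bil r + 2 * ennreal m * ?pot r z \<le> ?c j"
  have "\<exists>r m z. ?P j r m z" for j
  proof -
    have "C < ?c j"
      using Cfin ennreal_add_left_cancel_less[of C 0 "ennreal (1 / real (Suc j))"] by auto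
    then have "\<exists>X\<in>{Q_rel l q \<rho> M | (\<rho> :: real ^ 'n \<Rightarrow> real) M. \<rho> \<in> densities q \<and> M \<ge> 0}. X < ?c j"
      unfolding C_def C_rel_def Inf_less_iff .
    then obtain r0 :: "real ^ 'n \<Rightarrow> real" and M where r0: "r0 \<in> densities q" "0 \<le> M" "Q_rel l q r0 M < ?c j"
      by blast
    obtain r :: "real ^ 'n \<Rightarrow> real" and m where r: "r \<in> borel_measurable lebesgue" "\<And>x. 0 \<le> r x" "0 \<le> m"
      "(\<integral>\<^sup>+x. ennreal (r x) \<partial>lebesgue) + ennreal m = 1" "(\<integral>\<^sup>+x. ennreal (r x powr q) \<partial>lebesgue) = 1"
      "?bil r + 2 * ennreal m * ?pot r 0 = Q_rel l q r0 M"
      using normalize_scale[OF r0(1,2) q0 q1, of l] by blast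
    have en: "?bil r + 2 * ennreal m * ?pot r 0 < ?c j" using r(6) r0(3) by simp
    obtain t where t: "?pot (\<lambda>x. r (t + x)) 0 \<le> ?c j"
      using normalize_translate[OF r(1-4) en] by blast
    note [measurable] = r(1)
    have T: "(\<lambda>x. t + 1 *\<^sub>R x) \<in> (lebesgue :: (real ^ 'n) measure) \<rightarrow>\<^sub>M lebesgue"
      by (rule measurable_lebesgue_affine) simp
    have rt: "(\<lambda>x. r (t + x)) \<in> borel_measurable lebesgue"
      using measurable_compose[OF T r(1)] by simp
    have "(\<integral>\<^sup>+x. ennreal (r (t + x)) \<partial>lebesgue) = (\<integral>\<^sup>+x. ennreal (r x) \<partial>lebesgue)"
      "(\<integral>\<^sup>+x. ennreal (r (t + x) powr q) \<partial>lebesgue) = (\<integral>\<^sup>+x. ennreal (r x powr q) \<partial>lebesgue)"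
      "?bil (\<lambda>x. r (t + x)) = ?bil r" "?pot (\<lambda>x. r (t + x)) (- t) = ?pot r 0"
      using nn_integral_lebesgue_affine[of "\<lambda>x. ennreal (r x)" 1 t]
        nn_integral_lebesgue_affine[of "\<lambda>x. ennreal (r x powr q)" 1 t]
        bilin_affine[of "\<lambda>x. ennreal (r x)" 1 l t] pot_affine[of "\<lambda>x. ennreal (r x)" 1 l t "- t"] by simp_all
    \<comment> \<open>Translating the density carries the Dirac mass from the origin to
      \<open>- t\<close>, which becomes \<open>z j\<close>.\<close>
    then have "?P j (\<lambda>x. r (t + x)) m (- t)"
      using r(2-5) rt t en by (simp add: less_imp_le)
    then show ?thesis by blast
  qed
  then obtain r m z where P: "\<And>j. ?P j (r j) (m j) (z j)" by metis
  have c_lim: "?c \<longlonglongrightarrow> C"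
  proof -
    have "(\<lambda>j. 1 / real (Suc j)) \<longlonglongrightarrow> 0"
      using LIMSEQ_inverse_real_of_nat by (simp add: inverse_eq_divide)
    from tendsto_add[OF tendsto_const tendsto_ennrealI[OF this], of C] show ?thesis by simp
  qed
  have cB: "?c j \<le> ennreal (enn2real C + 1)" for j
  proof -
    have "?c j \<le> C + ennreal 1" by (intro add_left_mono ennreal_leI) simp
    then show ?thesis using Cfin by (simp add: ennreal_plus)
  qed
  have "\<exists>(h :: real ^ 'n \<Rightarrow> real) M y. h \<in> borel_measurable lebesgue \<and> (\<forall>x. 0 \<le> h x) \<and> 0 \<le> M \<and>
    (\<integral>\<^sup>+x. ennreal (h x) \<partial>lebesgue) + ennreal M = 1 \<and>
    1 \<le> (\<integral>\<^sup>+x. ennreal (h x powr q) \<partial>lebesgue) \<and> (\<integral>\<^sup>+x. ennreal (h x powr q) \<partial>lebesgue) < top \<and>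
    ?bil h + 2 * ennreal M * ?pot h y \<le> C"
  proof (rule compactness[where r=r and m=m and z=z and c="?c" and B="enn2real C + 1"])
    show "?pot (r j) 0 \<le> ennreal (enn2real C + 1)" for j using P[of j] cB[of j] by (blast intro: order_trans)
  qed (use P c_lim assms(1,2) q1 in auto)
  then obtain h :: "real ^ 'n \<Rightarrow> real" and M y where h[measurable]: "h \<in> borel_measurable lebesgue" and h0: "\<And>x. 0 \<le> h x"
    and M: "0 \<le> M" and mass: "(\<integral>\<^sup>+x. ennreal (h x) \<partial>lebesgue) + ennreal M = 1"
    and h1: "1 \<le> (\<integral>\<^sup>+x. ennreal (h x powr q) \<partial>lebesgue)" and hfin: "(\<integral>\<^sup>+x. ennreal (h x powr q) \<partial>lebesgue) < top"
    and en: "?bil h + 2 * ennreal M * ?pot h y \<le> C"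
    by blast
  \<comment> \<open>Moving \<open>y\<close> to the origin turns the potential at \<open>y\<close>
    into the moment that enters \<open>Q_rel\<close>.\<close>
  define \<rho> where "\<rho> x = h (y + x)" for x
  have T: "(\<lambda>x. y + 1 *\<^sub>R x) \<in> (lebesgue :: (real ^ 'n) measure) \<rightarrow>\<^sub>M lebesgue"
    by (rule measurable_lebesgue_affine) simp
  have rho[measurable]: "\<rho> \<in> borel_measurable lebesgue"
    using measurable_compose[OF T h] by (simp add: \<rho>_def[abs_def])
  have rho0: "0 \<le> \<rho> x" for x using h0 by (simp add: \<rho>_def)
  have i1: "(\<integral>\<^sup>+x. ennreal (\<rho> x) \<partial>lebesgue) = (\<integral>\<^sup>+x. ennreal (h x) \<partial>lebesgue)"
    and i2: "(\<integral>\<^sup>+x. ennreal (\<rho> x powr q) \<partial>lebesgue) = (\<integral>\<^sup>+x. ennreal (h x powr q) \<partial>lebesgue)"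
    and i3: "?bil \<rho> = ?bil h" and i4: "?pot \<rho> 0 = ?pot h y"
    using nn_integral_lebesgue_affine[of "\<lambda>x. ennreal (h x)" 1 y]
        nn_integral_lebesgue_affine[of "\<lambda>x. ennreal (h x powr q)" 1 y]
        bilin_affine[of "\<lambda>x. ennreal (h x)" 1 l y] pot_affine[of "\<lambda>x. ennreal (h x)" 1 l y 0]
    by (simp_all add: \<rho>_def)
  have "(\<integral>\<^sup>+x. ennreal (h x) \<partial>lebesgue) \<le> 1" using mass by (metis add_increasing2 order_refl zero_le)
  then have fin1: "(\<integral>\<^sup>+x. ennreal (\<rho> x) \<partial>lebesgue) < top" unfolding i1 by (rule le_less_trans) simp
  have rho_dens: "\<rho> \<in> densities q"
  proof -
    have "\<not> (AE x in lebesgue. \<rho> x = 0)"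
    proof
      assume "AE x in lebesgue. \<rho> x = 0"
      then have "AE x in lebesgue. ennreal (\<rho> x powr q) = 0" by eventually_elim simp
      then have "(\<integral>\<^sup>+x. ennreal (\<rho> x powr q) \<partial>lebesgue) = 0" by (subst nn_integral_0_iff_AE) auto
      then show False using h1 by (simp add: i2)
    qed
    then show ?thesis
      using fin1 hfin rho rho0 by (simp add: densities_def Lp_def i2)
  qed
  let ?S = "\<integral>x. \<rho> x \<partial>lebesgue" and ?s = "\<integral>x. \<rho> x powr q \<partial>lebesgue"
  note D = densitiesD[OF rho_dens]
  have "ennreal (?S + M) = 1"
    using mass D(3,4) M by (simp add: i1[symmetric] ennreal_plus[symmetric] del: ennreal_plus)
  then have SM: "?S + M = 1" by simp
  have s1: "1 \<le> ?s"
  proof -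
    have "ennreal 1 \<le> ennreal ?s" using h1 by (simp add: D(5)[symmetric] i2)
    then show ?thesis using D(6) by (subst (asm) ennreal_le_iff) auto
  qed
  \<comment> \<open>The first factor of the denominator is 1 because the total mass is 1. With a
    nonnegative exponent and \<open>?s \<ge> 1\<close> the second is at least 1, so the quotient is
    at most its numerator.\<close>
  have "0 \<le> (2 - alpha CARD('n) l q) / q"
  proof -
    have "2 - alpha CARD('n) l q = q * l / (real CARD('n) * (1 - q))"
      using q1 by (simp add: alpha_def field_simps)
    then show ?thesis using q0 q1 assms(1) by simp
  qed
  then have d: "1 \<le> ?s powr ((2 - alpha CARD('n) l q) / q)" using s1 by (rule ge_one_powr_ge_zero[rotated])
  have "Q_rel l q \<rho> M = (?bil h + 2 * ennreal M * ?pot h y) / ennreal (?s powr ((2 - alpha CARD('n) l q) / q))"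
    unfolding Q_rel_def SM energy_eq_bilin[OF rho0] moment_eq_pot[OF rho0] i3 i4 by simp
  also have "\<dots> \<le> C / ennreal (?s powr ((2 - alpha CARD('n) l q) / q))"
    by (rule divide_right_mono_ennreal[OF en])
  also have "\<dots> \<le> C / 1"
  proof -
    have "inverse (ennreal t) \<le> 1" if "1 \<le> t" for t
      using that inverse_ennreal[of t] ennreal_leI[of "inverse t" 1] by (simp add: inverse_le_1_iff)
    with d show ?thesis unfolding divide_ennreal_def by (intro mult_left_mono) simp_all
  qed
  finally have "Q_rel l q \<rho> M \<le> C" by (simp add: divide_ennreal_def)
  moreover have "C \<le> Q_rel l q \<rho> M"
    unfolding C_def C_rel_def using rho_dens M by (intro Inf_lower) auto
  ultimately show ?thesis using rho_dens M unfolding C_def by (intro exI[of _ \<rho>] exI[of _ M]) auto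
qed

end
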